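(* Let $\theta\mapsto\rho(\theta)$ be a smooth ($C^1$) spin-half model with parameter $\theta=(\theta_1,\dots,\theta_p)$ ranging over an open subset of $\mathbb{R}^p$, which is either a pure-state model or a mixed-state model, and let $I_Q(\theta)$ be its quantum information matrix. For each $n\ge 1$ let $M^{(n)}$ be a measurement on the system $\rho(\theta)^{\otimes n}$ of $n$ copies; if the model is a mixed-state model, assume in addition that every $M^{(n)}$ can be refined to a measurement of product form. For each $n$ let $\widehat\theta^{(n)}$ be an $\mathbb{R}^p$-valued estimator of $\theta$ that is a measurable function of the outcome of $M^{(n)}$, and let $$V^{(n)}(\theta)=\mathrm{E}_\theta\big[(\widehat\theta^{(n)}-\theta)(\widehat\theta^{(n)}-\theta)^\top\big]$$ be its mean quadratic error matrix. Suppose that on some open set of parameter values $\theta$: 1. $nV^{(n)}(\theta)$ converges uniformly, as $n\to\infty$, to a continuous limit $V(\theta)$; 2. $I_Q(\theta)$ is continuous with bounded partial derivatives; 3. $V(\theta)$ and $I_Q(\theta)$ are non-singular. Then for every $\theta$ in this open set the limiting normalised mean quadratic error matrix satisfies $$\operatorname{trace}\big(I_Q(\theta)^{-1}V(\theta)^{-1}\big)\le 1.$$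
   Context: **States.** A density matrix on $\mathbb{C}^d$ is a $d\times d$ complex self-adjoint nonnegative (positive semidefinite) matrix of trace $1$. A spin-half model is a family $\rho(\theta)$ of density matrices on $\mathbb{C}^2$. Every $2\times2$ density matrix is uniquely of the form $\rho(\vec a)=\frac12(\mathbf 1+a_x\sigma_x+a_y\sigma_y+a_z\sigma_z)$, with $\vec a\in\mathbb{R}^3$, $\|\vec a\|\le1$, and $\sigma_x,\sigma_y,\sigma_z$ the Pauli matrices. The model is a pure-state model if $\|\vec a\|=1$ for all $\theta$ (equivalently, each $\rho(\theta)$ is a rank-one projector). It is a mixed-state model if $\|\vec a\|<1$ for all $\theta$ (equivalently, each $\rho(\theta)$ is invertible). The state of $n$ copies is $\rho(\theta)^{\otimes n}$ on $(\mathbb{C}^2)^{\otimes n}$. **Measurements.** A measurement $M$ on a $d$-dimensional system with values in a measurable space $(\mathcal X,\mathcal A)$ is a collection of self-adjoint nonnegative $d\times d$ matrices $M(A)$, $A\in\mathcal A$, that is countably additive over disjoint sets and satisfies $M(\mathcal X)=\mathbf 1$. When $M$ is carried out on a system in state $\rho$, the outcome $X$ is random with distribution $\Pr\{X\in A\}=\operatorname{trace}(\rho M(A))$. For a measurement $M^{(n)}$ on $n$ copies, $\mathrm{E}_\theta$ denotes expectation under the outcome distribution $A\mapsto\operatorname{trace}(\rho(\theta)^{\otimes n}M^{(n)}(A))$. **Refinement and product form.** A measurement $N$ with sample space $\mathcal X$ is a refinement of a measurement $M$ with sample space $\mathcal Y$ if there is a measurable $f:\mathcal X\to\mathcal Y$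 with $M(B)=N(f^{-1}(B))$ for all measurable $B\subseteq\mathcal Y$. A measurement $N$ on $n$ copies of a two-dimensional system is of product form if $N(A)=\int_A N_1(x)\otimes\cdots\otimes N_n(x)\,\mu(\mathrm{d}x)$ for some ordinary (scalar, nonnegative) measure $\mu$ on $\mathcal X$ and measurable functions $N_1,\dots,N_n$ with values in the nonnegative self-adjoint $2\times2$ matrices. A measurement can be refined to product form if it has a refinement that is of product form. **Quantum information.** For a differentiable model $\rho(\theta)$, the quantum scores are self-adjoint matrices $\lambda_i(\theta)$, $i=1,\dots,p$, solving $$\frac{\partial\rho(\theta)}{\partial\theta_i}=\tfrac12\big(\lambda_i\rho+\rho\lambda_i\big).$$ When $\rho$ is singular, the undetermined entries of $\lambda_i$ may be chosen arbitrarily, subject to self-adjointness, without affecting $I_Q$; for pure states one may take $\lambda_i=2\,\partial\rho/\partial\theta_i$. The quantum information matrix is the $p\times p$ real positive semidefinite matrix $I_Q(\theta)$ with entries $$(I_Q)_{ij}=\tfrac12\operatorname{trace}\big(\rho(\lambda_i\lambda_j+\lambda_j\lambda_i)\big).$$ *)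

theory Defs
  imports "HOL-Analysis.Analysis"
begin

text \<open>
  A single spin-half system lives on the library type \<^typ>\<open>complex^2^2\<close>.  The dimension of the
  \<open>n\<close>-copy system depends on the variable \<open>n\<close>, so its operators are matrices
  \<open>A :: 'i \<Rightarrow> 'i \<Rightarrow> complex\<close> indexed by an explicit finite set \<open>I\<close> of basis labels; entries outside
  \<open>I\<close> are irrelevant.
\<close>

definition self_adjoint_on :: "'i set \<Rightarrow> ('i \<Rightarrow> 'i \<Rightarrow> complex) \<Rightarrow> bool" where
  "self_adjoint_on I A \<longleftrightarrow> (\<forall>i\<in>I. \<forall>j\<in>I. A j i = cnj (A i j))"

text \<open>The quadratic form of a self-adjoint matrix is real, so taking its real part loses nothing.\<close>

definition nonneg_on :: "'i set \<Rightarrow> ('i \<Rightarrow> 'i \<Rightarrow> complex) \<Rightarrow> bool" where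
  "nonneg_on I A \<longleftrightarrow> self_adjoint_on I A \<and>
     (\<forall>v. 0 \<le> Re (\<Sum>i\<in>I. \<Sum>j\<in>I. cnj (v i) * A i j * v j))"

abbreviation self_adjoint :: "complex^'d^'d \<Rightarrow> bool" where
  "self_adjoint A \<equiv> self_adjoint_on UNIV (\<lambda>i j. A $ i $ j)"

abbreviation nonneg :: "complex^'d^'d \<Rightarrow> bool" where
  "nonneg A \<equiv> nonneg_on UNIV (\<lambda>i j. A $ i $ j)"

definition density_matrix :: "complex^'d^'d \<Rightarrow> bool" where
  "density_matrix \<rho> \<longleftrightarrow> nonneg \<rho> \<and> trace \<rho> = 1"


definition sigma_x :: "complex^2^2" where
  "sigma_x = vector [vector [0, 1], vector [1, 0]]"

definition sigma_y :: "complex^2^2" where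
  "sigma_y = vector [vector [0, - \<i>], vector [\<i>, 0]]"

definition sigma_z :: "complex^2^2" where
  "sigma_z = vector [vector [1, 0], vector [0, - 1]]"

definition bloch_state :: "real^3 \<Rightarrow> complex^2^2" where
  "bloch_state a =
     (1/2) *\<^sub>R (mat 1 + (a $ 1) *\<^sub>R sigma_x + (a $ 2) *\<^sub>R sigma_y + (a $ 3) *\<^sub>R sigma_z)"

definition spin_half_model :: "(real^'p) set \<Rightarrow> (real^'p \<Rightarrow> complex^2^2) \<Rightarrow> bool" where
  "spin_half_model \<Theta> \<rho> \<longleftrightarrow> (\<forall>\<theta>\<in>\<Theta>. density_matrix (\<rho> \<theta>))"

definition pure_state_model :: "(real^'p) set \<Rightarrow> (real^'p \<Rightarrow> complex^2^2) \<Rightarrow> bool" where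
  "pure_state_model \<Theta> \<rho> \<longleftrightarrow> (\<forall>\<theta>\<in>\<Theta>. \<exists>a. \<rho> \<theta> = bloch_state a \<and> norm a = 1)"

definition mixed_state_model :: "(real^'p) set \<Rightarrow> (real^'p \<Rightarrow> complex^2^2) \<Rightarrow> bool" where
  "mixed_state_model \<Theta> \<rho> \<longleftrightarrow> (\<forall>\<theta>\<in>\<Theta>. \<exists>a. \<rho> \<theta> = bloch_state a \<and> norm a < 1)"

definition C1_on ::
    "(real^'p) set \<Rightarrow> (real^'p \<Rightarrow> 'b::real_normed_vector) \<Rightarrow> bool" where
  "C1_on \<Theta> f \<longleftrightarrow> (\<exists>f' :: real^'p \<Rightarrow> ((real^'p) \<Rightarrow>\<^sub>L 'b).
     (\<forall>\<theta>\<in>\<Theta>. (f has_derivative blinfun_apply (f' \<theta>)) (at \<theta>)) \<and> continuous_on \<Theta> f')"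

definition has_partial_derivative ::
    "(real^'p \<Rightarrow> 'b::real_normed_vector) \<Rightarrow> 'b \<Rightarrow> 'p \<Rightarrow> real^'p \<Rightarrow> bool" where
  "has_partial_derivative f D i \<theta> \<longleftrightarrow>
     ((\<lambda>t. f (\<theta> + t *\<^sub>R axis i 1)) has_vector_derivative D) (at 0)"


definition is_quantum_score ::
    "(real^'p \<Rightarrow> complex^2^2) \<Rightarrow> real^'p \<Rightarrow> 'p \<Rightarrow> complex^2^2 \<Rightarrow> bool" where
  "is_quantum_score \<rho> \<theta> i L \<longleftrightarrow> self_adjoint L \<and>
     has_partial_derivative \<rho> ((1/2) *\<^sub>R (L ** \<rho> \<theta> + \<rho> \<theta> ** L)) i \<theta>"

text \<open>
  If \<open>\<rho> \<theta>\<close> is singular then the score is not unique; any choice gives the same information matrix.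
\<close>

definition quantum_score ::
    "(real^'p \<Rightarrow> complex^2^2) \<Rightarrow> real^'p \<Rightarrow> 'p \<Rightarrow> complex^2^2" where
  "quantum_score \<rho> \<theta> i = (SOME L. is_quantum_score \<rho> \<theta> i L)"

text \<open>The trace below is real, because the scores and \<open>\<rho> \<theta>\<close> are self-adjoint.\<close>

definition quantum_information :: "(real^'p \<Rightarrow> complex^2^2) \<Rightarrow> real^'p \<Rightarrow> real^'p^'p" where
  "quantum_information \<rho> \<theta> = (\<chi> i j.
     (1/2) * Re (trace (\<rho> \<theta> ** (quantum_score \<rho> \<theta> i ** quantum_score \<rho> \<theta> j
                              + quantum_score \<rho> \<theta> j ** quantum_score \<rho> \<theta> i))))"


text \<open>
  The standard product basis of the \<open>n\<close>-fold tensor power of \<open>\<complex>\<^sup>2\<close>: the label \<open>s\<close> stands for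
  \<open>e (s!0) \<otimes> \<dots> \<otimes> e (s!(n-1))\<close>, where \<open>e\<close> is the standard basis of \<open>\<complex>\<^sup>2\<close>.
\<close>

definition copies_basis :: "nat \<Rightarrow> 2 list set" where
  "copies_basis n = {s. length s = n}"

definition tensor :: "nat \<Rightarrow> (nat \<Rightarrow> complex^2^2) \<Rightarrow> 2 list \<Rightarrow> 2 list \<Rightarrow> complex" where
  "tensor n A s t = (\<Prod>k<n. A k $ (s ! k) $ (t ! k))"

definition tensor_power :: "nat \<Rightarrow> complex^2^2 \<Rightarrow> 2 list \<Rightarrow> 2 list \<Rightarrow> complex" where
  "tensor_power n A = tensor n (\<lambda>_. A)"


text \<open>
  In the following, the argument \<open>X :: 'x measure\<close> only supplies the measurable space
  \<open>(space X, sets X)\<close> of outcomes; its measure is never used.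
\<close>

definition measurement ::
    "'i set \<Rightarrow> 'x measure \<Rightarrow> ('x set \<Rightarrow> 'i \<Rightarrow> 'i \<Rightarrow> complex) \<Rightarrow> bool" where
  "measurement I X M \<longleftrightarrow>
     (\<forall>A\<in>sets X. nonneg_on I (M A)) \<and>
     (\<forall>A :: nat \<Rightarrow> 'x set. range A \<subseteq> sets X \<longrightarrow> disjoint_family A \<longrightarrow>
        (\<forall>i\<in>I. \<forall>j\<in>I. (\<lambda>k. M (A k) i j) sums M (\<Union>k. A k) i j)) \<and>
     (\<forall>i\<in>I. \<forall>j\<in>I. M (space X) i j = (if i = j then 1 else 0))"

text \<open>
  Born's rule.  The trace of a product of two nonnegative matrices is real and nonnegative.
\<close>

definition outcome_distribution ::
    "'i set \<Rightarrow> ('i \<Rightarrow> 'i \<Rightarrow> complex) \<Rightarrow> 'x measure \<Rightarrow> ('x set \<Rightarrow> 'i \<Rightarrow> 'i \<Rightarrow> complex) \<Rightarrow> 'x measure"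
  where
  "outcome_distribution I \<rho> X M =
     measure_of (space X) (sets X) (\<lambda>A. ennreal (Re (\<Sum>i\<in>I. \<Sum>j\<in>I. \<rho> i j * M A j i)))"

definition refinement ::
    "'i set \<Rightarrow> 'y measure \<Rightarrow> ('y set \<Rightarrow> 'i \<Rightarrow> 'i \<Rightarrow> complex) \<Rightarrow>
     'x measure \<Rightarrow> ('x set \<Rightarrow> 'i \<Rightarrow> 'i \<Rightarrow> complex) \<Rightarrow> bool" where
  "refinement I Y N X M \<longleftrightarrow> (\<exists>f \<in> Y \<rightarrow>\<^sub>M X.
     \<forall>B\<in>sets X. \<forall>i\<in>I. \<forall>j\<in>I. M B i j = N (f -` B \<inter> space Y) i j)"

definition product_form ::
    "nat \<Rightarrow> 'y measure \<Rightarrow> ('y set \<Rightarrow> 2 list \<Rightarrow> 2 list \<Rightarrow> complex) \<Rightarrow> bool" where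
  "product_form n Y N \<longleftrightarrow> (\<exists>(\<mu> :: 'y measure) (F :: nat \<Rightarrow> 'y \<Rightarrow> complex^2^2).
     space \<mu> = space Y \<and> sets \<mu> = sets Y \<and>
     (\<forall>k<n. F k \<in> borel_measurable \<mu> \<and> (\<forall>x\<in>space \<mu>. nonneg (F k x))) \<and>
     (\<forall>A\<in>sets \<mu>. \<forall>s\<in>copies_basis n. \<forall>t\<in>copies_basis n.
        set_integrable \<mu> A (\<lambda>x. tensor n (\<lambda>k. F k x) s t) \<and>
        N A s t = (LINT x:A|\<mu>. tensor n (\<lambda>k. F k x) s t)))"


abbreviation copies_distribution ::
    "nat \<Rightarrow> complex^2^2 \<Rightarrow> 'x measure \<Rightarrow> ('x set \<Rightarrow> 2 list \<Rightarrow> 2 list \<Rightarrow> complex) \<Rightarrow> 'x measure" where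
  "copies_distribution n \<rho> X M \<equiv> outcome_distribution (copies_basis n) (tensor_power n \<rho>) X M"

text \<open>
  The Bochner integral of a non-integrable function is 0, so that the mean quadratic error is only
  meaningful together with the predicate \<open>mse_finite\<close>.
\<close>

definition mse_finite :: "'x measure \<Rightarrow> ('x \<Rightarrow> real^'p) \<Rightarrow> real^'p \<Rightarrow> bool" where
  "mse_finite P est \<theta> \<longleftrightarrow>
     (\<forall>i j. integrable P (\<lambda>x. (est x $ i - \<theta> $ i) * (est x $ j - \<theta> $ j)))"

definition mse_matrix :: "'x measure \<Rightarrow> ('x \<Rightarrow> real^'p) \<Rightarrow> real^'p \<Rightarrow> real^'p^'p" where
  "mse_matrix P est \<theta> =
     (\<chi> i j. integral\<^sup>L P (\<lambda>x. (est x $ i - \<theta> $ i) * (est x $ j - \<theta> $ j)))"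

definition bounded_partial_derivatives_on ::
    "(real^'p) set \<Rightarrow> (real^'p \<Rightarrow> 'b::real_normed_vector) \<Rightarrow> bool" where
  "bounded_partial_derivatives_on U f \<longleftrightarrow>
     (\<forall>i. \<exists>D. (\<forall>\<theta>\<in>U. has_partial_derivative f (D \<theta>) i \<theta>) \<and> bounded (D ` U))"

end

theory Submission
  imports Defs
begin

text \<open>
  For every measurement on \<open>n\<close> copies (of product form, if the states are mixed) there is a matrix \<open>K\<close> of
  trace \<open>n\<close> with \<open>2 tr(\<rho>\<^sub>h M(A)) \<le> n (h \<bullet> I\<^sub>Q h) P(A) + tr(K M(A)) / n\<close> for all events \<open>A\<close> and all directions \<open>h\<close>,
  where \<open>\<rho>\<^sub>h\<close> is the derivative of the \<open>n\<close>-copy state along \<open>h\<close>.  Summing over a partition while letting \<open>h\<close>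
  depend on the event gives the trace bound on the classical Fisher information in dual form, without densities.

  Put \<open>D = V\<inverse> I\<^sub>Q\<inverse>\<close> at a point where \<open>T = tr D > 1\<close>, replace the estimator by one with finitely many
  values, and take \<open>h = D\<^sup>T (y - \<theta>)\<close> on the event that the value is \<open>y\<close>.  The bound then says that the
  divergence of the vector field \<open>D\<^sup>T bias(\<theta>)\<close> is at most a negative constant near that point, uniformly in \<open>n\<close>.
  But the field itself is \<open>O(1 / sqrt n)\<close>, and integrating by parts against a bump function gives a
  contradiction.  This plays the role of the van Trees inequality.
\<close>

section \<open>Pauli coordinates\<close>

text \<open>The threshold 1 arises as follows. Since I_Q D^T V = 1 at the chosen point, n times the
  mean of h . I_Q h with h = D^T (estimate - \<theta>) tends to tr(D I_Q D^T V) = tr D = T, and the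
  trace of \<open>K\<close> over n adds 1. So the derivative terms sum to about (T + 1)/2 at most,
  while the -\<theta> in the bias contributes -T: the divergence is at most about (1 - T)/2,
  negative once T > 1. \<open>D\<close> stays frozen at the point, so that differentiating the field
  only differentiates the bias. The price is that I_Q varies nearby; a small multiple of |z|^2 added
  to the quadratic form absorbs this, and the coercivity it brings also yields the 1/sqrt n bound on
  the field. Finitely many values make the bias a finite sum of polynomials in the entries of the
  state, so nothing is differentiated under an integral over outcomes. \<open>K\<close> must serve
  all directions at once. For pure states it is a projector-like rank-one matrix, because the
  orthogonal complement of a vector in C^2 is a line; for mixed states it comes from expanding the
  square of a sum of one-copy scores, whose terms are products of one-copy traces, and this is where
  the product form enters.\<close>

definition pauli :: "real \<Rightarrow> real^3 \<Rightarrow> complex^2^2" where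
  "pauli s v = s *\<^sub>R mat 1 + (v $ 1) *\<^sub>R sigma_x + (v $ 2) *\<^sub>R sigma_y + (v $ 3) *\<^sub>R sigma_z"

lemma pauli_entries:
  "pauli s v $ 1 $ 1 = complex_of_real (s + v $ 3)"
  "pauli s v $ 1 $ 2 = Complex (v $ 1) (- (v $ 2))"
  "pauli s v $ 2 $ 1 = Complex (v $ 1) (v $ 2)"
  "pauli s v $ 2 $ 2 = complex_of_real (s - v $ 3)"
  by (simp_all add: pauli_def sigma_x_def sigma_y_def sigma_z_def mat_def vector_2 complex_eq_iff)

lemma matrix2_eq_iff:
  "A = B \<longleftrightarrow> A $ 1 $ 1 = B $ 1 $ 1 \<and> A $ 1 $ 2 = B $ 1 $ 2 \<and> A $ 2 $ 1 = B $ 2 $ 1 \<and> A $ 2 $ 2 = B $ 2 $ 2"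
  for A B :: "'a^2^2"
  by (auto simp: vec_eq_iff forall_2)

lemma bloch_state_pauli: "bloch_state a = pauli (1/2) ((1/2) *\<^sub>R a)"
  by (simp add: bloch_state_def pauli_def algebra_simps)

lemma trace_pauli: "trace (pauli s v) = complex_of_real (2 * s)"
  by (simp add: trace_def sum_2 pauli_entries)

lemma inner_vec3: "v \<bullet> w = v $ 1 * w $ 1 + v $ 2 * w $ 2 + v $ 3 * w $ 3" for v w :: "real^3"
  by (simp add: inner_vec_def sum_3)

lemma trace_pauli_mult: "trace (pauli s v ** pauli t w) = complex_of_real (2 * (s * t + v \<bullet> w))"
  by (simp add: trace_def sum_2 matrix_matrix_mult_def pauli_entries complex_eq_iff inner_vec3
      algebra_simps)

lemma pauli_anticommutator:
  "pauli s v ** pauli t w + pauli t w ** pauli s v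
    = pauli (2 * (s * t + v \<bullet> w)) (2 *\<^sub>R (s *\<^sub>R w + t *\<^sub>R v))"
  by (simp add: matrix2_eq_iff sum_2 matrix_matrix_mult_def pauli_entries complex_eq_iff
      inner_vec3 algebra_simps)

lemma pauli_add: "pauli s v + pauli t w = pauli (s + t) (v + w)"
  by (simp add: pauli_def algebra_simps)

lemma pauli_scaleR: "c *\<^sub>R pauli s v = pauli (c * s) (c *\<^sub>R v)"
  by (simp add: pauli_def algebra_simps)

lemma pauli_square: "pauli s v ** pauli s v = pauli (s * s + v \<bullet> v) ((2 * s) *\<^sub>R v)"
proof -
  have "pauli s v ** pauli s v = (1/2) *\<^sub>R (pauli s v ** pauli s v + pauli s v ** pauli s v)"
    by (simp add: scaleR_2[symmetric])
  then show ?thesis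
    unfolding pauli_anticommutator pauli_scaleR
    by (simp add: scaleR_2[symmetric] add_divide_distrib)
qed

lemma pauli_inject: "pauli s v = pauli t w \<longleftrightarrow> s = t \<and> v = w"
  by (auto simp: matrix2_eq_iff pauli_entries complex_eq_iff vec_eq_iff forall_3)

lemma self_adjoint_pauli: "self_adjoint (pauli s v)"
  by (simp add: self_adjoint_on_def forall_2 pauli_entries complex_eq_iff)

lemma self_adjoint_pauliE:
  assumes "self_adjoint L"
  obtains s v where "L = pauli s v"
proof
  have sa: "L$2$1 = cnj (L$1$2)" "Im (L$1$1) = 0" "Im (L$2$2) = 0"
  proof -
    have h: "L$j$i = cnj (L$i$j)" for i j using assms unfolding self_adjoint_on_def by blast
    show "L$2$1 = cnj (L$1$2)" by (rule h)
    have "Im (L$i$i) = 0" for i using arg_cong[OF h[of i i], of Im] by simp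
    then show "Im (L$1$1) = 0" "Im (L$2$2) = 0" by auto
  qed
  show "L = pauli ((Re (L$1$1) + Re (L$2$2))/2)
      (vector [Re (L$1$2), - Im (L$1$2), (Re (L$1$1) - Re (L$2$2))/2])"
    unfolding matrix2_eq_iff pauli_entries
    using arg_cong[OF sa(1), of Re] arg_cong[OF sa(1), of Im] sa(2) sa(3)
    by (simp add: complex_eq_iff field_simps)
qed

text \<open>The determinant is s^2 - |v|^2, so nonnegativity is membership in a round cone; the
  quadratic form is tested at vectors that expose first the diagonal entries and then the
  determinant.\<close>

lemma nonneg_pauliD:
  assumes "nonneg (pauli s v)"
  shows "norm v \<le> s"
proof -
  have pos: "0 \<le> Re (\<Sum>i\<in>UNIV. \<Sum>j\<in>UNIV. cnj (x i) * pauli s v $ i $ j * x j)" for x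
    using assms by (simp add: nonneg_on_def)
  define N where "N = norm v"
  have N2: "N\<^sup>2 = (v$1)\<^sup>2 + (v$2)\<^sup>2 + (v$3)\<^sup>2"
    unfolding N_def power2_norm_eq_inner by (simp only: inner_vec3 power2_eq_square)
  have a: "0 \<le> s + v$3" using pos[of "\<lambda>i. if i = 1 then 1 else 0"] by (simp add: sum_2 pauli_entries)
  have b: "0 \<le> s - v$3" using pos[of "\<lambda>i. if i = 2 then 1 else 0"] by (simp add: sum_2 pauli_entries)
  show ?thesis
  proof (cases "s + v$3 = 0")
    case False
    \<comment> \<open>This vector is annihilated by the first row, so the form at it is the upper
      left entry times the determinant.\<close>
    let ?z = "\<lambda>i::2. if i = 1 then - Complex (v$1) (-(v$2)) else complex_of_real (s + v$3)"
    have "0 \<le> (s + v$3) * (s\<^sup>2 - N\<^sup>2)"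
      using pos[of ?z] unfolding N2 by (simp add: sum_2 pauli_entries power2_eq_square algebra_simps)
    then have "N\<^sup>2 \<le> s\<^sup>2" using a False by (simp add: zero_le_mult_iff)
    then show ?thesis using a b unfolding N_def by (simp add: power2_le_iff_abs_le)
  next
    case True
    \<comment> \<open>With a zero in the upper left corner the form is affine in \<open>c\<close>;
      being bounded below, it must have slope 0, so the off-diagonal entry vanishes.\<close>
    have "0 \<le> - 2 * c * ((v$1)\<^sup>2 + (v$2)\<^sup>2) + 2 * s" for c
      using pos[of "\<lambda>i::2. if i = 1 then - complex_of_real c * Complex (v$1) (-(v$2)) else 1"] True
      by (simp add: sum_2 pauli_entries power2_eq_square algebra_simps)
    from this[of "(s + 1) / ((v$1)\<^sup>2 + (v$2)\<^sup>2)"] have z: "(v$1)\<^sup>2 + (v$2)\<^sup>2 = 0"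
      by (cases "(v$1)\<^sup>2 + (v$2)\<^sup>2 = 0") auto
    then have "N\<^sup>2 = s\<^sup>2" unfolding N2 using True
      by (metis add.commute add_0 eq_neg_iff_add_eq_0 power2_minus)
    then show ?thesis using a b unfolding N_def by (simp add: power2_eq_iff_nonneg)
  qed
qed

lemma nonneg_pauliE:
  assumes "nonneg F"
  obtains s v where "F = pauli s v" "norm v \<le> s"
  using assms by (metis nonneg_on_def self_adjoint_pauliE nonneg_pauliD)

text \<open>Defined on all matrices rather than only self-adjoint ones, so that it is real-linear on
  the whole space and commutes with differentiation.\<close>

definition pauli_vec :: "complex^2^2 \<Rightarrow> real^3" where
  "pauli_vec A = vector [Re (A$1$2 + A$2$1) / 2, Im (A$2$1 - A$1$2) / 2, Re (A$1$1 - A$2$2) / 2]"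

lemma pauli_vec_pauli: "pauli_vec (pauli s v) = v"
  by (simp add: pauli_vec_def pauli_entries vec_eq_iff forall_3 vector_3)

lemma bounded_linear_pauli_vec: "bounded_linear pauli_vec"
proof (rule linear_conv_bounded_linear[THEN iffD1], rule linearI)
  fix x y :: "complex^2^2" and r :: real
  show "pauli_vec (x + y) = pauli_vec x + pauli_vec y" "pauli_vec (r *\<^sub>R x) = r *\<^sub>R pauli_vec x"
    by (simp_all add: pauli_vec_def vec_eq_iff forall_3 vector_3 field_simps)
qed

lemma bounded_linear_pauli0: "bounded_linear (pauli 0)"
proof (rule linear_conv_bounded_linear[THEN iffD1], rule linearI)
  fix x y :: "real^3" and r :: real
  show "pauli 0 (x + y) = pauli 0 x + pauli 0 y" "pauli 0 (r *\<^sub>R x) = r *\<^sub>R pauli 0 x"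
    by (simp_all add: pauli_add pauli_scaleR)
qed

section \<open>Tensor powers and measurements\<close>

lemma copies_basis_0: "copies_basis 0 = {[]}"
  by (auto simp: copies_basis_def)

lemma copies_basis_Suc: "copies_basis (Suc n) = (\<lambda>(i, s). i # s) ` (UNIV \<times> copies_basis n)"
  by (auto simp: copies_basis_def length_Suc_conv image_iff)

lemma finite_copies_basis: "finite (copies_basis n)"
  by (induction n) (simp_all add: copies_basis_0 copies_basis_Suc)

text \<open>This is the distributive law for a product of sums, proved by splitting off the first
  factor. It makes traces of tensor products factor over the copies.\<close>

lemma sum_copies_basis_prod:
  fixes g :: "nat \<Rightarrow> 2 \<Rightarrow> 'a::comm_semiring_1"
  shows "(\<Sum>s\<in>copies_basis n. \<Prod>k<n. g k (s ! k)) = (\<Prod>k<n. \<Sum>i\<in>UNIV. g k i)"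
proof (induction n arbitrary: g)
  case 0
  then show ?case by (simp add: copies_basis_0)
next
  case (Suc n)
  have inj: "inj_on (\<lambda>(i, s). i # s) (UNIV \<times> copies_basis n)"
    by (auto simp: inj_on_def)
  have "(\<Sum>s\<in>copies_basis (Suc n). \<Prod>k<Suc n. g k (s ! k))
      = (\<Sum>i\<in>UNIV. \<Sum>s\<in>copies_basis n. g 0 i * (\<Prod>k<n. g (Suc k) (s ! k)))"
    unfolding copies_basis_Suc sum.reindex[OF inj] sum.cartesian_product
    by (intro sum.cong) (auto simp: prod.lessThan_Suc_shift simp del: prod.lessThan_Suc)
  also have "\<dots> = (\<Sum>i\<in>UNIV. g 0 i) * (\<Prod>k<n. \<Sum>i\<in>UNIV. g (Suc k) i)"
    unfolding sum_distrib_left[symmetric] Suc.IH[of "\<lambda>k. g (Suc k)"] by (simp add: sum_distrib_right)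
  finally show ?case by (simp add: prod.lessThan_Suc_shift del: prod.lessThan_Suc)
qed

definition mtrace :: "'i set \<Rightarrow> ('i \<Rightarrow> 'i \<Rightarrow> complex) \<Rightarrow> ('i \<Rightarrow> 'i \<Rightarrow> complex) \<Rightarrow> complex" where
  "mtrace I A B = (\<Sum>i\<in>I. \<Sum>j\<in>I. A i j * B j i)"

lemma mtrace_sum_left: "mtrace I (\<lambda>i j. \<Sum>k\<in>K. f k i j) B = (\<Sum>k\<in>K. mtrace I (f k) B)"
proof -
  have "mtrace I (\<lambda>i j. \<Sum>k\<in>K. f k i j) B = (\<Sum>i\<in>I. \<Sum>k\<in>K. \<Sum>j\<in>I. f k i j * B j i)"
    unfolding mtrace_def sum_distrib_right by (intro sum.cong refl sum.swap)
  also have "\<dots> = (\<Sum>k\<in>K. mtrace I (f k) B)"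
    unfolding mtrace_def by (rule sum.swap)
  finally show ?thesis .
qed

lemma mtrace_sum_right: "mtrace I A (\<lambda>i j. \<Sum>k\<in>K. f k i j) = (\<Sum>k\<in>K. mtrace I A (f k))"
proof -
  have "mtrace I A (\<lambda>i j. \<Sum>k\<in>K. f k i j) = (\<Sum>i\<in>I. \<Sum>k\<in>K. \<Sum>j\<in>I. A i j * f k j i)"
    unfolding mtrace_def sum_distrib_left by (intro sum.cong refl sum.swap)
  also have "\<dots> = (\<Sum>k\<in>K. mtrace I A (f k))"
    unfolding mtrace_def by (rule sum.swap)
  finally show ?thesis .
qed

lemma mtrace_add_left: "mtrace I (\<lambda>i j. f i j + g i j) B = mtrace I f B + mtrace I g B"
  unfolding mtrace_def by (simp add: distrib_right sum.distrib)

lemma mtrace_diff_left: "mtrace I (\<lambda>i j. f i j - g i j) B = mtrace I f B - mtrace I g B"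
  unfolding mtrace_def by (simp add: left_diff_distrib sum_subtractf)

lemma mtrace_tensor:
  "mtrace (copies_basis n) (tensor n A) (tensor n B) = (\<Prod>k<n. trace (A k ** B k))"
proof -
  have "mtrace (copies_basis n) (tensor n A) (tensor n B)
     = (\<Sum>s\<in>copies_basis n. \<Prod>k<n. \<Sum>j\<in>UNIV. A k $ (s ! k) $ j * B k $ j $ (s ! k))"
    unfolding mtrace_def tensor_def prod.distrib[symmetric]
    by (subst sum_copies_basis_prod[symmetric]) simp
  also have "\<dots> = (\<Prod>k<n. trace (A k ** B k))"
    by (subst sum_copies_basis_prod) (simp add: trace_def matrix_matrix_mult_def)
  finally show ?thesis .
qed

lemma trace_tensor: "(\<Sum>s\<in>copies_basis n. tensor n A s s) = (\<Prod>k<n. trace (A k))"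
  unfolding tensor_def trace_def by (rule sum_copies_basis_prod)

lemma prod_fun_upd:
  "finite I \<Longrightarrow> k \<in> I \<Longrightarrow> (\<Prod>j\<in>I. f ((A(k := R)) j) j) = f R k * (\<Prod>j\<in>I - {k}. f (A j) j)"
  by (subst prod.remove[of I k]) (auto intro!: prod.cong)

text \<open>The Leibniz rule: the derivative of the \<open>n\<close>-th tensor power at
  \<open>\<rho>\<close> in direction \<open>R\<close>, one summand for each differentiated
  factor.\<close>

definition dtensor :: "nat \<Rightarrow> complex^2^2 \<Rightarrow> complex^2^2 \<Rightarrow> 2 list \<Rightarrow> 2 list \<Rightarrow> complex" where
  "dtensor n \<rho> R s t = (\<Sum>k<n. tensor n ((\<lambda>_. \<rho>)(k := R)) s t)"

lemma dtensor_alt: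
  "dtensor n \<rho> R s t
    = (\<Sum>k<n. R $ (s ! k) $ (t ! k) * (\<Prod>j\<in>{..<n} - {k}. \<rho> $ (s ! j) $ (t ! j)))"
  unfolding dtensor_def tensor_def
  by (intro sum.cong refl prod_fun_upd[where f = "\<lambda>A j. A $ (_ ! j) $ (_ ! j)"]) auto

lemma has_derivative_mtrace_tensor_power:
  assumes "(\<rho> has_derivative \<rho>') (at \<theta>)"
  shows "((\<lambda>\<theta>. mtrace I (tensor_power n (\<rho> \<theta>)) B) has_derivative
           (\<lambda>h. mtrace I (dtensor n (\<rho> \<theta>) (\<rho>' h)) B)) (at \<theta>)"
proof -
  have "((\<lambda>\<theta>. \<rho> \<theta> $ i $ j) has_derivative (\<lambda>h. \<rho>' h $ i $ j)) (at \<theta>)" for i j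
    by (intro bounded_linear.has_derivative[OF bounded_linear_vec_nth] assms)
  then show ?thesis
    unfolding mtrace_def tensor_power_def tensor_def dtensor_alt
    by (intro has_derivative_sum has_derivative_mult_left has_derivative_prod) auto
qed

lemma continuous_on_mtrace_dtensor:
  assumes "continuous_on S \<rho>" "continuous_on S R"
  shows "continuous_on S (\<lambda>\<theta>. mtrace I (dtensor n (\<rho> \<theta>) (R \<theta>)) B)"
  unfolding mtrace_def dtensor_alt by (intro continuous_intros assms)

section \<open>Finite additivity of measurements and traces over partitions\<close>

lemma measurement_empty:
  assumes "measurement I X M" "i \<in> I" "j \<in> I"
  shows "M {} i j = 0"
proof -
  have "(\<lambda>k::nat. M {} i j) sums M {} i j"
    using assms unfolding measurement_def
    by (auto dest!: spec[of _ "\<lambda>_::nat. {}"] simp: disjoint_family_on_def)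
  then show ?thesis by (simp add: summable_const_iff[symmetric] sums_iff)
qed

lemma measurement_sums:
  assumes "measurement I X M" "i \<in> I" "j \<in> I" "range A \<subseteq> sets X" "disjoint_family A"
  shows "(\<lambda>k. M (A k) i j) sums M (\<Union>k. A k) i j"
  using assms unfolding measurement_def by blast

lemma measurement_finite_UN:
  assumes M: "measurement I X M" "i \<in> I" "j \<in> I"
    and "finite K" "\<And>k. k \<in> K \<Longrightarrow> A k \<in> sets X" "disjoint_family_on A K"
  shows "M (\<Union>k\<in>K. A k) i j = (\<Sum>k\<in>K. M (A k) i j)"
proof -
  obtain f and N :: nat where f: "bij_betw f {..<N} K"
    using ex_bij_betw_nat_finite[OF \<open>finite K\<close>] atLeast0LessThan by metis
  define B where "B k = (if k < N then A (f k) else {})" for k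
  have fK: "k < N \<Longrightarrow> f k \<in> K" for k using f by (auto simp: bij_betw_def)
  have "disjoint_family B"
  proof (unfold disjoint_family_on_def, intro ballI impI)
    fix k l :: nat assume "k \<noteq> l"
    show "B k \<inter> B l = {}"
    proof (cases "k < N \<and> l < N")
      case True
      then have "f k \<noteq> f l" using f \<open>k \<noteq> l\<close> by (auto simp: bij_betw_def inj_on_def)
      then show ?thesis using True assms(6) fK by (auto simp: B_def disjoint_family_on_def)
    qed (auto simp: B_def)
  qed
  moreover have "range B \<subseteq> sets X" using assms(5) fK by (auto simp: B_def)
  ultimately have "(\<lambda>k. M (B k) i j) sums M (\<Union>k. B k) i j"
    using measurement_sums[OF M] by blast
  moreover have "(\<lambda>k. M (B k) i j) sums (\<Sum>k<N. M (B k) i j)"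
    by (rule sums_finite) (auto simp: B_def measurement_empty[OF M])
  moreover have "(\<Union>k. B k) = (\<Union>k\<in>K. A k)"
    using f by (auto simp: B_def bij_betw_def split: if_splits)
  moreover have "(\<Sum>k<N. M (B k) i j) = (\<Sum>k\<in>K. M (A k) i j)"
    using sum.reindex_bij_betw[OF f, of "\<lambda>k. M (A k) i j"] by (simp add: B_def)
  ultimately show ?thesis by (metis sums_unique2)
qed

lemma mtrace_cong: "(\<And>i j. i \<in> I \<Longrightarrow> j \<in> I \<Longrightarrow> B i j = C i j) \<Longrightarrow> mtrace I A B = mtrace I A C"
  unfolding mtrace_def by (intro sum.cong) auto

lemma mtrace_identity:
  assumes "finite I"
  shows "mtrace I T (\<lambda>i j. if i = j then 1 else 0) = (\<Sum>i\<in>I. T i i)"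
  unfolding mtrace_def using assms by (simp add: if_distrib sum.delta cong: if_cong)

text \<open>By additivity the sum is the trace of \<open>T\<close> against the identity. Applied to
  the state it gives total probability 1, and applied to \<open>K\<close> it gives trace
  \<open>n\<close>.\<close>

lemma mtrace_measurement_partition:
  assumes M: "measurement I X M"
    and "finite K" "\<And>k. k \<in> K \<Longrightarrow> A k \<in> sets X" "disjoint_family_on A K" "(\<Union>k\<in>K. A k) = space X"
    and "finite I"
  shows "(\<Sum>k\<in>K. mtrace I T (M (A k))) = (\<Sum>i\<in>I. T i i)"
proof -
  have "(\<Sum>k\<in>K. mtrace I T (M (A k))) = mtrace I T (M (space X))"
    unfolding mtrace_sum_right[symmetric] assms(5)[symmetric]
    by (intro mtrace_cong measurement_finite_UN[OF M, symmetric] assms) auto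
  also have "\<dots> = mtrace I T (\<lambda>i j. if i = j then 1 else 0)"
    using M by (intro mtrace_cong) (auto simp: measurement_def)
  also have "\<dots> = (\<Sum>i\<in>I. T i i)"
    by (rule mtrace_identity[OF \<open>finite I\<close>])
  finally show ?thesis .
qed

text \<open>A Cholesky factorization. On the boundary of the cone the determinant vanishes and one
  vector suffices, which yields the state vector of a pure state.\<close>

lemma pauli_factorization:
  assumes "norm v \<le> s"
  obtains b c :: "2 \<Rightarrow> complex"
  where "\<And>i j. pauli s v $ i $ j = b i * cnj (b j) + c i * cnj (c j)"
    "norm v = s \<Longrightarrow> c = (\<lambda>_. 0)"
proof (cases "s + v $ 3 = 0")
  case True
  have s: "0 \<le> s" using assms norm_ge_zero order_trans by blast
  have n: "(norm v)\<^sup>2 = (v$1)\<^sup>2 + (v$2)\<^sup>2 + (v$3)\<^sup>2"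
    unfolding power2_norm_eq_inner by (simp only: inner_vec3 power2_eq_square)
  have "(norm v)\<^sup>2 \<le> s\<^sup>2" using assms by (intro power_mono) auto
  moreover have "(v$3)\<^sup>2 = s\<^sup>2" using True by (metis add.commute eq_neg_iff_add_eq_0 power2_minus)
  ultimately have z: "(v$1)\<^sup>2 + (v$2)\<^sup>2 \<le> 0" unfolding n by simp
  have v0: "v$1 = 0" "v$2 = 0"
    using z sum_power2_le_zero_iff by blast+
  show ?thesis
  proof
    fix i j :: 2
    show "pauli s v $ i $ j = (if i = 1 then 0 else complex_of_real (sqrt (2 * s))) *
        cnj (if j = 1 then 0 else complex_of_real (sqrt (2 * s))) + 0 * cnj 0"
      using exhaust_2[of i] exhaust_2[of j] True v0 s
      by (auto simp: pauli_entries complex_eq_iff simp flip: of_real_mult)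
  qed auto
next
  case False
  define p where "p = s + v $ 3"
  \<comment> \<open>The Schur complement: determinant divided by the upper left entry.\<close>
  define r where "r = (s\<^sup>2 - (norm v)\<^sup>2) / p"
  have n: "(norm v)\<^sup>2 = (v$1)\<^sup>2 + (v$2)\<^sup>2 + (v$3)\<^sup>2"
    unfolding power2_norm_eq_inner by (simp only: inner_vec3 power2_eq_square)
  have "\<bar>v$3\<bar> \<le> s" using assms component_le_norm_cart[of v 3] by linarith
  then have p: "0 < p" using False unfolding p_def by linarith
  have "(norm v)\<^sup>2 \<le> s\<^sup>2" using assms by (intro power_mono) auto
  then have r: "0 \<le> r" unfolding r_def using p by simp
  let ?b = "\<lambda>i::2. if i = 1 then complex_of_real (sqrt p) else Complex (v$1) (v$2) / complex_of_real (sqrt p)"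
  let ?c = "\<lambda>i::2. if i = 1 then 0 else complex_of_real (sqrt r)"
  have sq: "complex_of_real (sqrt p) * complex_of_real (sqrt p) = complex_of_real p"
    "complex_of_real (sqrt r) * complex_of_real (sqrt r) = complex_of_real r"
    using p r by (simp_all flip: of_real_mult)
  have sp: "sqrt p \<noteq> 0" using p by simp
  have d: "((v$1)\<^sup>2 + (v$2)\<^sup>2) / p + r = s - v$3"
  proof -
    have "((v$1)\<^sup>2 + (v$2)\<^sup>2) / p + r = (s - v$3) * p / p"
      unfolding r_def n add_divide_distrib[symmetric] p_def
      by (intro arg_cong2[where f = "(/)"]) (simp_all add: algebra_simps power2_eq_square)
    then show ?thesis using p by simp
  qed
  show ?thesis
  proof
    fix i j :: 2
    have "Complex (v$1) (v$2) / complex_of_real (sqrt p) * cnj (Complex (v$1) (v$2) / complex_of_real (sqrt p))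
        = complex_of_real (((v$1)\<^sup>2 + (v$2)\<^sup>2) / p)"
      using p by (simp add: complex_eq_iff power2_eq_square sq flip: of_real_mult)
    then have "pauli s v $ 2 $ 2 = ?b 2 * cnj (?b 2) + ?c 2 * cnj (?c 2)"
      unfolding pauli_entries d[symmetric] using sq(2) by simp
    then show "pauli s v $ i $ j = ?b i * cnj (?b j) + ?c i * cnj (?c j)"
      using exhaust_2[of i] exhaust_2[of j] sq sp
      by (auto simp: pauli_entries p_def[symmetric] complex_eq_iff add_divide_distrib)
  next
    assume "norm v = s"
    then show "?c = (\<lambda>_. 0)" by (auto simp: r_def)
  qed
qed

section \<open>Information bounds for pure and mixed states\<close>

text \<open>The trace condition says that L \<psi> is orthogonal to \<psi>, hence a multiple c of
  one fixed unit vector \<open>perp\<close>. So the derivative of the product vector is c/2 times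
  \<open>\<Phi>\<close>, the sum of the product vectors with one factor replaced by
  \<open>perp\<close>. These are orthonormal, so |\<open>\<Phi>\<close>|^2 = \<open>n\<close>, and
  \<open>K\<close> is the rank-one matrix of \<open>\<Phi>\<close>. Only the scalar c depends on
  \<open>L\<close>, which is why \<open>K\<close> does not.\<close>

lemma pure_information_bound:
  fixes \<psi> :: "2 \<Rightarrow> complex" and \<rho> :: "complex^2^2"
  assumes n: "n \<ge> 1" and unit: "\<psi> 1 * cnj (\<psi> 1) + \<psi> 2 * cnj (\<psi> 2) = 1"
    and \<rho>: "\<And>i j. \<rho> $ i $ j = \<psi> i * cnj (\<psi> j)"
  obtains K where "Re (\<Sum>s\<in>copies_basis n. K s s) = real n"
    "\<And>L M. self_adjoint L \<Longrightarrow> trace (\<rho> ** L) = 0 \<Longrightarrow> nonneg_on (copies_basis n) M \<Longrightarrow>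
      2 * Re (mtrace (copies_basis n) (dtensor n \<rho> ((1/2) *\<^sub>R (L ** \<rho> + \<rho> ** L))) M)
       \<le> real n * Re (trace (\<rho> ** (L ** L))) * Re (mtrace (copies_basis n) (tensor_power n \<rho>) M)
          + Re (mtrace (copies_basis n) K M) / real n"
proof -
  define perp where "perp = (\<lambda>i::2. if i = 1 then - cnj (\<psi> 2) else cnj (\<psi> 1))"
  define I where "I = copies_basis n"
  define \<Psi> where "\<Psi> s = (\<Prod>j<n. \<psi> (s ! j))" for s :: "2 list"
  define \<phi> where "\<phi> k s = (\<Prod>j<n. ((\<lambda>_. \<psi>)(k := perp)) j (s ! j))" for k and s :: "2 list"
  define \<Phi> where "\<Phi> s = (\<Sum>k<n. \<phi> k s)" for s
  have perp: "perp 1 = - cnj (\<psi> 2)" "perp 2 = cnj (\<psi> 1)"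
    by (simp_all add: perp_def)
  have unitP: "perp 1 * cnj (perp 1) + perp 2 * cnj (perp 2) = 1"
    using unit by (simp add: perp algebra_simps)
  have ortho: "(\<Sum>i\<in>UNIV. perp i * cnj (\<psi> i)) = 0" "(\<Sum>i\<in>UNIV. \<psi> i * cnj (perp i)) = 0"
    by (simp_all add: sum_2 perp algebra_simps)
  have unit': "(\<Sum>i\<in>UNIV. \<psi> i * cnj (\<psi> i)) = 1" "(\<Sum>i\<in>UNIV. perp i * cnj (perp i)) = 1"
    using unit unitP by (simp_all add: sum_2)
  have inner: "(\<Sum>s\<in>I. \<phi> k s * cnj (\<phi> k' s)) = (if k = k' then 1 else 0)"
    if "k < n" "k' < n" for k k'
  proof -
    have "(\<Sum>s\<in>I. \<phi> k s * cnj (\<phi> k' s))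
        = (\<Prod>j<n. \<Sum>i\<in>UNIV. ((\<lambda>_. \<psi>)(k := perp)) j i * cnj (((\<lambda>_. \<psi>)(k' := perp)) j i))"
      unfolding \<phi>_def I_def cnj_prod prod.distrib[symmetric]
      by (rule sum_copies_basis_prod)
    also have "\<dots> = (if k = k' then 1 else 0)"
    proof (cases "k = k'")
      case True
      then show ?thesis by (auto intro!: prod.neutral simp: unit')
    next
      case False
      then show ?thesis using that by (auto intro!: prod_zero bexI[of _ k] simp: ortho)
    qed
    finally show ?thesis .
  qed
  define K where "K s t = \<Phi> s * cnj (\<Phi> t)" for s t
  have "(\<Sum>s\<in>I. K s s) = (\<Sum>k<n. \<Sum>k'<n. \<Sum>s\<in>I. \<phi> k s * cnj (\<phi> k' s))"
    unfolding K_def \<Phi>_def cnj_sum sum_product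
    by (subst sum.swap, intro sum.cong refl, subst sum.swap, rule refl)
  also have "\<dots> = of_nat n" by (simp add: inner)
  finally have trK: "(\<Sum>s\<in>I. K s s) = of_nat n" .
  have main: "2 * Re (mtrace I (dtensor n \<rho> ((1/2) *\<^sub>R (L ** \<rho> + \<rho> ** L))) M)
       \<le> real n * Re (trace (\<rho> ** (L ** L))) * Re (mtrace I (tensor_power n \<rho>) M)
          + Re (mtrace I K M) / real n"
    if L: "self_adjoint L" and tr: "trace (\<rho> ** L) = 0" and M: "nonneg_on I M" for L M
  proof -
    define x where "x i = (\<Sum>j\<in>UNIV. L $ i $ j * \<psi> j)" for i
    define c where "c = cnj (perp 1) * x 1 + cnj (perp 2) * x 2"
    define R where "R = (1/2) *\<^sub>R (L ** \<rho> + \<rho> ** L)"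
    have sa: "L $ j $ i = cnj (L $ i $ j)" for i j
      using L unfolding self_adjoint_on_def by blast
    have "cnj (\<psi> 1) * x 1 + cnj (\<psi> 2) * x 2 = trace (\<rho> ** L)"
      by (simp add: x_def trace_def sum_2 matrix_matrix_mult_def \<rho> algebra_simps)
    then have z: "cnj (\<psi> 1) * x 1 + cnj (\<psi> 2) * x 2 = 0" using tr by simp
    \<comment> \<open>Expansion of L \<psi> in the orthonormal basis \<psi>, \<open>perp\<close>,
      whose \<psi>-coefficient is the trace of \<rho> L, that is 0.\<close>
    have "x i = c * perp i" for i
    proof -
      have "x 1 = x 1 * (\<psi> 1 * cnj (\<psi> 1) + \<psi> 2 * cnj (\<psi> 2))"
        "x 2 = x 2 * (\<psi> 1 * cnj (\<psi> 1) + \<psi> 2 * cnj (\<psi> 2))" using unit by simp_all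
      moreover have "x 1 * (\<psi> 1 * cnj (\<psi> 1) + \<psi> 2 * cnj (\<psi> 2)) - c * perp 1
          = \<psi> 1 * (cnj (\<psi> 1) * x 1 + cnj (\<psi> 2) * x 2)"
        "x 2 * (\<psi> 1 * cnj (\<psi> 1) + \<psi> 2 * cnj (\<psi> 2)) - c * perp 2
          = \<psi> 2 * (cnj (\<psi> 1) * x 1 + cnj (\<psi> 2) * x 2)"
        by (simp_all add: c_def perp algebra_simps)
      ultimately show ?thesis using z exhaust_2[of i] by auto
    qed
    note x = this
    have L\<rho>: "(L ** \<rho>) $ i $ j = c * perp i * cnj (\<psi> j)" for i j
      unfolding x[symmetric] x_def
      by (simp add: matrix_matrix_mult_def \<rho> sum_2 algebra_simps)
    have "(\<rho> ** L) $ i $ j = \<psi> i * cnj (x j)" for i j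
      unfolding x_def sum_2 matrix_matrix_mult_def complex_cnj_add complex_cnj_mult sa[symmetric]
      by (simp add: \<rho> sum_2 algebra_simps)
    then have \<rho>L: "(\<rho> ** L) $ i $ j = cnj c * \<psi> i * cnj (perp j)" for i j
      by (simp add: x)
    have R: "R $ i $ j = (c * perp i * cnj (\<psi> j) + cnj c * \<psi> i * cnj (perp j)) / 2" for i j
      unfolding R_def vector_scaleR_component vector_add_component L\<rho> \<rho>L
      by (simp add: scaleR_conv_of_real)
    \<comment> \<open>Cycling the trace turns it into the squared norm of L \<psi>, which is
      |c|^2.\<close>
    have "trace (\<rho> ** (L ** L)) = trace ((\<rho> ** L) ** L)" by (simp add: matrix_mul_assoc)
    also have "\<dots> = trace (L ** (\<rho> ** L))" by (rule trace_mul_sym)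
    also have "\<dots> = trace ((L ** \<rho>) ** L)" by (simp add: matrix_mul_assoc)
    also have "\<dots> = c * (cnj (x 1) * perp 1 + cnj (x 2) * perp 2)"
      unfolding x_def sum_2 complex_cnj_add complex_cnj_mult sa[symmetric]
      by (simp add: trace_def sum_2 matrix_matrix_mult_def[of "L ** \<rho>" L] L\<rho> algebra_simps)
    also have "\<dots> = c * cnj c * (perp 1 * cnj (perp 1) + perp 2 * cnj (perp 2))"
      by (simp add: x algebra_simps)
    finally have q: "trace (\<rho> ** (L ** L)) = c * cnj c" using unitP by simp
    define Q where "Q y z = (\<Sum>i\<in>I. \<Sum>j\<in>I. cnj (y i) * M i j * z j)" for y z
    have saM: "M j i = cnj (M i j)" if "i \<in> I" "j \<in> I" for i j
      using M that unfolding nonneg_on_def self_adjoint_on_def by blast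
    have Qsym: "Q z y = cnj (Q y z)" for y z
    proof -
      have "Q z y = (\<Sum>j\<in>I. \<Sum>i\<in>I. cnj (z i) * M i j * y j)" unfolding Q_def by (rule sum.swap)
      also have "\<dots> = cnj (Q y z)" unfolding Q_def cnj_sum
        by (intro sum.cong refl) (simp add: saM[symmetric])
      finally show ?thesis .
    qed
    have Qm: "mtrace I (\<lambda>s t. y s * cnj (z t)) M = Q z y" for y z
      unfolding mtrace_def Q_def by (subst sum.swap) (simp add: algebra_simps)
    have Qpos: "0 \<le> Re (Q y y)" for y using M unfolding nonneg_on_def Q_def by blast
    have "tensor_power n \<rho> = (\<lambda>s t. \<Psi> s * cnj (\<Psi> t))"
      unfolding tensor_power_def tensor_def \<Psi>_def by (simp add: \<rho> prod.distrib fun_eq_iff)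
    then have P: "mtrace I (tensor_power n \<rho>) M = Q \<Psi> \<Psi>" by (simp add: Qm)
    have \<phi>': "\<phi> k s = perp (s ! k) * (\<Prod>j\<in>{..<n} - {k}. \<psi> (s ! j))" if "k < n" for k s
      unfolding \<phi>_def using that
      by (intro prod_fun_upd[where f = "\<lambda>f j. f (s ! j)"]) auto
    have \<Psi>': "\<Psi> s = \<psi> (s ! k) * (\<Prod>j\<in>{..<n} - {k}. \<psi> (s ! j))" if "k < n" for k s
      unfolding \<Psi>_def using that by (subst prod.remove[of _ k]) auto
    have "dtensor n \<rho> R s t = (c * (\<Phi> s * cnj (\<Psi> t)) + cnj c * (\<Psi> s * cnj (\<Phi> t))) / 2" for s t
    proof -
      have "dtensor n \<rho> R s t
          = (\<Sum>k<n. (c * (\<phi> k s * cnj (\<Psi> t)) + cnj c * (\<Psi> s * cnj (\<phi> k t))) / 2)"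
        unfolding dtensor_alt
        by (intro sum.cong refl) (simp add: R \<phi>' \<Psi>'[of _ s] \<Psi>'[of _ t] \<rho> prod.distrib algebra_simps)
      then show ?thesis unfolding \<Phi>_def cnj_sum
        by (simp add: sum_distrib_left sum_distrib_right sum.distrib sum_divide_distrib add_divide_distrib)
    qed
    then have "mtrace I (dtensor n \<rho> R) M
        = mtrace I (\<lambda>s t. (c * (\<Phi> s * cnj (\<Psi> t)) + cnj c * (\<Psi> s * cnj (\<Phi> t))) / 2) M"
      by (intro arg_cong[where f = "\<lambda>T. mtrace I T M"] ext)
    also have "\<dots> = (c * mtrace I (\<lambda>s t. \<Phi> s * cnj (\<Psi> t)) M + cnj c * mtrace I (\<lambda>s t. \<Psi> s * cnj (\<Phi> t)) M) / 2"
      unfolding mtrace_def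
      by (simp add: sum_distrib_left sum.distrib sum_divide_distrib algebra_simps add_divide_distrib)
    also have "\<dots> = (c * Q \<Psi> \<Phi> + cnj (c * Q \<Psi> \<Phi>)) / 2" unfolding Qm by (simp add: Qsym[of \<Phi> \<Psi>])
    also have "\<dots> = complex_of_real (Re (c * Q \<Psi> \<Phi>))"
      by (simp only: complex_eq_iff) simp
    finally have D: "Re (mtrace I (dtensor n \<rho> R) M) = Re (c * Q \<Psi> \<Phi>)"
      by (simp only: Re_complex_of_real)
    \<comment> \<open>the claim is nonnegativity of the quadratic form of \<open>M\<close> at \<open>n cnj(c) \<Psi> - \<Phi>\<close>, divided by \<open>n\<close>\<close>
    let ?y = "\<lambda>s. of_nat n * cnj c * \<Psi> s - \<Phi> s"
    have "Q ?y ?y = of_nat n * of_nat n * (c * cnj c) * Q \<Psi> \<Psi> - of_nat n * c * Q \<Psi> \<Phi>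
        - of_nat n * cnj c * Q \<Phi> \<Psi> + Q \<Phi> \<Phi>"
      unfolding Q_def sum_distrib_left sum_subtractf[symmetric] sum.distrib[symmetric]
      by (intro sum.cong refl) (simp add: algebra_simps)
    also have "\<dots> = complex_of_real (real n * real n * Re (c * cnj c)) * Q \<Psi> \<Psi>
        - complex_of_real (real n) * (c * Q \<Psi> \<Phi> + cnj (c * Q \<Psi> \<Phi>)) + Q \<Phi> \<Phi>"
      by (simp add: Qsym[of \<Phi> \<Psi>] complex_mult_cnj algebra_simps)
    finally have "0 \<le> Re \<dots>" using Qpos[of ?y] by simp
    then have "0 \<le> real n * real n * Re (c * cnj c) * Re (Q \<Psi> \<Psi>) - 2 * real n * Re (c * Q \<Psi> \<Phi>) + Re (Q \<Phi> \<Phi>)"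
      by (simp add: algebra_simps)
    then have "2 * Re (c * Q \<Psi> \<Phi>) \<le> real n * Re (c * cnj c) * Re (Q \<Psi> \<Psi>) + Re (Q \<Phi> \<Phi>) / real n"
      using n by (simp add: field_simps)
    moreover have "Re (Q \<Phi> \<Phi>) = Re (mtrace I K M)"
      unfolding K_def Qm by simp
    ultimately show ?thesis unfolding R_def[symmetric] D P q by simp
  qed
  show thesis
    by (rule that[of K]) (use trK main in \<open>simp_all add: I_def\<close>)
qed

text \<open>
  With \<open>w = \<Sum>\<^sub>k v\<^sub>k / p\<^sub>k\<close>, this is \<open>g(n l - w, n l - w) \<ge> 0\<close> multiplied by \<open>\<Prod>\<^sub>k p\<^sub>k\<close>.  It is stated without division
  so that the right-hand side is a sum of traces of \<open>\<Otimes>\<^sub>k F\<^sub>k\<close> against product operators, and hence can be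
  integrated term by term even where some \<open>p\<^sub>k\<close> vanishes.
\<close>

lemma mixed_pointwise_bound:
  fixes a l :: "real^3" and v :: "nat \<Rightarrow> real^3" and p e :: "nat \<Rightarrow> real"
  defines "g \<equiv> \<lambda>x y. x \<bullet> y - (a \<bullet> x) * (a \<bullet> y)"
  assumes n: "n \<ge> 1" and a: "norm a \<le> 1"
    and p: "\<And>k. k < n \<Longrightarrow> 0 \<le> p k"
    and z: "\<And>k. k < n \<Longrightarrow> p k = 0 \<Longrightarrow> v k = 0 \<and> e k = 0"
    and e: "\<And>k. k < n \<Longrightarrow> g (v k) (v k) \<le> e k * p k"
  shows "2 * (\<Sum>k<n. g l (v k) * (\<Prod>j\<in>{..<n}-{k}. p j))
     \<le> real n * g l l * (\<Prod>j<n. p j) + ((\<Sum>k<n. e k * (\<Prod>j\<in>{..<n}-{k}. p j)) +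
         (\<Sum>k<n. \<Sum>k'\<in>{..<n}-{k}. g (v k) (v k') * (\<Prod>j\<in>{..<n}-{k}-{k'}. p j))) / real n"
proof (cases "\<exists>k0<n. p k0 = 0")
  \<comment> \<open>Each term contains copy \<open>k0\<close>, either through the factor
    \<open>p k0\<close> or through \<open>v k0\<close> or \<open>e k0\<close>, so every sum
    vanishes.\<close>
  case True
  then obtain k0 where k0: "k0 < n" "p k0 = 0" by blast
  then have 0: "v k0 = 0" "e k0 = 0" using z by auto
  have "g l (v k) * (\<Prod>j\<in>{..<n}-{k}. p j) = 0" "e k * (\<Prod>j\<in>{..<n}-{k}. p j) = 0" if "k < n" for k
    using k0 0 by (cases "k = k0"; force simp: g_def intro: prod_zero)+
  then have "(\<Sum>k<n. g l (v k) * (\<Prod>j\<in>{..<n}-{k}. p j)) = 0"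
    "(\<Sum>k<n. e k * (\<Prod>j\<in>{..<n}-{k}. p j)) = 0"
    by (auto intro!: sum.neutral simp del: prod_zero_iff mult_eq_0_iff)
  moreover have "g (v k) (v k') * (\<Prod>j\<in>{..<n}-{k}-{k'}. p j) = 0" for k k'
    using k0 0 by (cases "k = k0 \<or> k' = k0"; force simp: g_def intro: prod_zero)
  then have "(\<Sum>k<n. \<Sum>k'\<in>{..<n}-{k}. g (v k) (v k') * (\<Prod>j\<in>{..<n}-{k}-{k'}. p j)) = 0"
    by (auto intro!: sum.neutral simp del: prod_zero_iff mult_eq_0_iff)
  moreover have "(\<Prod>j<n. p j) = 0" using k0 by (auto intro: prod_zero)
  ultimately show ?thesis by (simp only:) simp
next
  case False
  then have pp: "0 < p k" if "k < n" for k using p[OF that] that by force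
  define P where "P = (\<Prod>j<n. p j)"
  have P: "0 < P" unfolding P_def using pp by (intro prod_pos) auto
  have P1: "(\<Prod>j\<in>{..<n}-{k}. p j) = P / p k" if "k < n" for k
    unfolding P_def using that pp[OF that] by (subst prod.remove[of "{..<n}" k]) auto
  have P2: "(\<Prod>j\<in>{..<n}-{k}-{k'}. p j) = P / (p k * p k')" if "k < n" "k' < n" "k' \<noteq> k" for k k'
  proof -
    have "(\<Prod>j\<in>{..<n}-{k}. p j) = p k' * (\<Prod>j\<in>{..<n}-{k}-{k'}. p j)"
      using that by (subst prod.remove[of "{..<n} - {k}" k']) auto
    then show ?thesis using P1[OF that(1)] pp[OF that(1)] pp[OF that(2)] by (simp add: field_simps)
  qed
  define w where "w = (\<Sum>k<n. (1 / p k) *\<^sub>R v k)"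
  have gsum_r: "g x (\<Sum>k\<in>J. f k) = (\<Sum>k\<in>J. g x (f k))" for x f and J :: "nat set"
    unfolding g_def by (simp add: inner_sum_right sum_subtractf sum_distrib_left)
  have gsum_l: "g (\<Sum>k\<in>J. f k) x = (\<Sum>k\<in>J. g (f k) x)" for x f and J :: "nat set"
    unfolding g_def by (simp add: inner_sum_right inner_sum_left sum_subtractf sum_distrib_right)
  have gs: "g x (c *\<^sub>R y) = c * g x y" "g (c *\<^sub>R x) y = c * g x y" for c x y
    unfolding g_def by (simp_all add: algebra_simps)
  have gpos: "0 \<le> g x x" for x
  proof -
    have "\<bar>a \<bullet> x\<bar> \<le> norm a * norm x" by (rule Cauchy_Schwarz_ineq2)
    also have "\<dots> \<le> norm x" using a by (simp add: mult_left_le_one_le)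
    finally have "\<bar>a \<bullet> x\<bar>\<^sup>2 \<le> (norm x)\<^sup>2" by (intro power_mono) auto
    then have "(a \<bullet> x)\<^sup>2 \<le> x \<bullet> x" by (simp only: power2_abs power2_norm_eq_inner)
    then show ?thesis unfolding g_def by (simp add: power2_eq_square)
  qed
  have gw: "g l w = (\<Sum>k<n. g l (v k) / p k)" unfolding w_def gsum_r gs by simp
  have "g w w = (\<Sum>k<n. \<Sum>k'<n. g (v k) (v k') / (p k * p k'))"
    unfolding w_def gsum_r gsum_l gs by (subst sum.swap) (simp add: sum_distrib_left mult.commute)
  also have "\<dots> = (\<Sum>k<n. g (v k) (v k) / (p k * p k) + (\<Sum>k'\<in>{..<n}-{k}. g (v k) (v k') / (p k * p k')))"
    by (intro sum.cong refl) (subst sum.remove[of "{..<n}"], auto)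
  \<comment> \<open>Diagonal terms are quadratic in a single copy and cannot be a trace against that
    copy. Bounding them by \<open>e k / p k\<close> makes everything linear in each copy once
    multiplied by the product of all \<open>p k\<close>.\<close>
  also have "\<dots> \<le> (\<Sum>k<n. e k / p k + (\<Sum>k'\<in>{..<n}-{k}. g (v k) (v k') / (p k * p k')))"
  proof (intro sum_mono add_right_mono)
    fix k assume "k \<in> {..<n}"
    then show "g (v k) (v k) / (p k * p k) \<le> e k / p k"
      using e[of k] pp[of k] by (simp add: field_simps)
  qed
  also have "\<dots> = (\<Sum>k<n. e k / p k) + (\<Sum>k<n. \<Sum>k'\<in>{..<n}-{k}. g (v k) (v k') / (p k * p k'))"
    by (simp add: sum.distrib)
  finally have ww: "g w w \<le> (\<Sum>k<n. e k / p k) + (\<Sum>k<n. \<Sum>k'\<in>{..<n}-{k}. g (v k) (v k') / (p k * p k'))" .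
  have "0 \<le> g (real n *\<^sub>R l - w) (real n *\<^sub>R l - w)" by (rule gpos)
  also have "\<dots> = real n * (real n * g l l) - 2 * real n * g l w + g w w"
    unfolding g_def by (simp add: algebra_simps inner_commute)
  finally have "2 * g l w \<le> real n * g l l + g w w / real n"
    using n by (simp add: field_simps)
  also have "\<dots> \<le> real n * g l l + ((\<Sum>k<n. e k / p k) + (\<Sum>k<n. \<Sum>k'\<in>{..<n}-{k}. g (v k) (v k') / (p k * p k'))) / real n"
    using ww by (intro add_left_mono divide_right_mono) auto
  finally have main: "P * (2 * (\<Sum>k<n. g l (v k) / p k)) \<le> P * (real n * g l l + ((\<Sum>k<n. e k / p k) + (\<Sum>k<n. \<Sum>k'\<in>{..<n}-{k}. g (v k) (v k') / (p k * p k'))) / real n)"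
    unfolding gw using P by (intro mult_left_mono) auto
  have e1: "(\<Sum>k<n. g l (v k) * (\<Prod>j\<in>{..<n}-{k}. p j)) = P * (\<Sum>k<n. g l (v k) / p k)"
    "(\<Sum>k<n. e k * (\<Prod>j\<in>{..<n}-{k}. p j)) = P * (\<Sum>k<n. e k / p k)"
    unfolding sum_distrib_left by (intro sum.cong refl; simp add: P1)+
  have e2: "(\<Sum>k<n. \<Sum>k'\<in>{..<n}-{k}. g (v k) (v k') * (\<Prod>j\<in>{..<n}-{k}-{k'}. p j))
      = P * (\<Sum>k<n. \<Sum>k'\<in>{..<n}-{k}. g (v k) (v k') / (p k * p k'))"
    unfolding sum_distrib_left by (intro sum.cong refl) (simp add: P2)
  show ?thesis using main unfolding e1 e2 P_def[symmetric] by (simp add: algebra_simps)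
qed

lemma prod_fun_upd_const:
  fixes k n :: nat
  assumes "k < n"
  shows "(\<Prod>j<n. f (((\<lambda>_. \<rho>)(k := A)) j) j) = f A k * (\<Prod>j\<in>{..<n}-{k}. f \<rho> j)"
  using assms by (intro prod_fun_upd) auto

lemma prod_fun_upd2_const:
  fixes k n :: nat
  assumes "k < n" "k' \<in> {..<n} - {k}"
  shows "(\<Prod>j<n. f (((\<lambda>_. \<rho>)(k := A, k' := B)) j) j)
    = f A k * f B k' * (\<Prod>j\<in>{..<n}-{k}-{k'}. f \<rho> j)"
proof -
  have "(\<Prod>j<n. f (((\<lambda>_. \<rho>)(k := A, k' := B)) j) j)
      = f B k' * (\<Prod>j\<in>{..<n}-{k'}. f (((\<lambda>_. \<rho>)(k := A)) j) j)"
    using assms by (intro prod_fun_upd) auto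
  also have "(\<Prod>j\<in>{..<n}-{k'}. f (((\<lambda>_. \<rho>)(k := A)) j) j)
      = f A k * (\<Prod>j\<in>{..<n}-{k'}-{k}. f \<rho> j)"
    using assms by (intro prod_fun_upd) auto
  also have "{..<n}-{k'}-{k} = {..<n}-{k}-{k'}" by auto
  finally show ?thesis by (simp only: mult_ac)
qed

text \<open>For F k = f + v . \<sigma> the numbers \<open>p k\<close> and \<open>e k\<close> are its
  traces against the state and against the antipodal state \<open>E\<close>, with Bloch vector
  \<open>- a\<close>. The derivative of \<open>p k\<close> in the direction with score
  \<open>L\<close> is \<open>g l (v k)\<close>, where \<open>g\<close> has matrix 1 - a a^T. The
  off-diagonal products \<open>g (v k) (v k')\<close> are traces against the tensors built from
  \<open>S\<close> and \<open>T\<close>. Hence every term of the pointwise bound is a trace against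
  the product operator, and the terms without \<open>l\<close> assemble into
  \<open>K\<close>.\<close>

lemma mixed_information_bound:
  fixes a :: "real^3"
  assumes n: "n \<ge> 1" and a: "norm a < 1"
  defines "\<rho> \<equiv> bloch_state a"
  obtains K where "Re (\<Sum>s\<in>copies_basis n. K s s) = real n"
    "\<And>L F. self_adjoint L \<Longrightarrow> trace (\<rho> ** L) = 0 \<Longrightarrow> (\<And>k. k < n \<Longrightarrow> nonneg (F k)) \<Longrightarrow>
      2 * Re (mtrace (copies_basis n) (dtensor n \<rho> ((1/2) *\<^sub>R (L ** \<rho> + \<rho> ** L))) (tensor n F))
       \<le> real n * Re (trace (\<rho> ** (L ** L))) * Re (mtrace (copies_basis n) (tensor_power n \<rho>) (tensor n F))
          + Re (mtrace (copies_basis n) K (tensor n F)) / real n"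
proof -
  define I where "I = copies_basis n"
  define S where "S = (\<lambda>i. pauli 0 ((1/2) *\<^sub>R axis i 1))"
  define T where "T = pauli 0 ((1/2) *\<^sub>R a)"
  define E where "E = pauli (1/2) ((1/2) *\<^sub>R (- a))"
  define \<rho>s where "\<rho>s = (\<lambda>_::nat. \<rho>)"
  define K where "K s t = (\<Sum>k<n. tensor n (\<rho>s(k := E)) s t) +
    (\<Sum>k<n. \<Sum>k'\<in>{..<n}-{k}. (\<Sum>i\<in>UNIV. tensor n (\<rho>s(k := S i, k' := S i)) s t)
        - tensor n (\<rho>s(k := T, k' := T)) s t)" for s t
  \<comment> \<open>the terms with two modified factors are the scores of different copies multiplied together;
    they have trace 0, because \<open>S\<close> and \<open>T\<close> do\<close>
  have \<rho>: "\<rho> = pauli (1/2) ((1/2) *\<^sub>R a)" unfolding \<rho>_def by (rule bloch_state_pauli)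
  have tr: "trace \<rho> = 1" "trace E = 1" "trace (S i) = 0" "trace T = 0" for i
    by (simp_all add: \<rho> E_def S_def T_def trace_pauli)
  let ?id = "\<lambda>i j. if i = j then 1 else 0 :: complex"
  have trt: "mtrace I (tensor n A) ?id = (\<Prod>j<n. trace (A j))" for A
    unfolding I_def mtrace_identity[OF finite_copies_basis] by (rule trace_tensor)
  have "(\<Sum>s\<in>I. K s s) = mtrace I K ?id"
    unfolding I_def mtrace_identity[OF finite_copies_basis] ..
  also have "\<dots> = (\<Sum>k<n. mtrace I (tensor n (\<rho>s(k := E))) ?id) +
    (\<Sum>k<n. \<Sum>k'\<in>{..<n}-{k}. (\<Sum>i\<in>UNIV. mtrace I (tensor n (\<rho>s(k := S i, k' := S i))) ?id)
        - mtrace I (tensor n (\<rho>s(k := T, k' := T))) ?id)"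
    unfolding mtrace_sum_left[symmetric] mtrace_diff_left[symmetric] mtrace_add_left[symmetric] K_def ..
  also have "\<dots> = (\<Sum>k<n. 1) + (\<Sum>k<n. \<Sum>k'\<in>{..<n}-{k}. (\<Sum>i\<in>(UNIV :: 3 set). 0) - 0)"
  proof (intro arg_cong2[where f = "(+)"] arg_cong2[where f = "(-)"] sum.cong refl)
    show "mtrace I (tensor n (\<rho>s(k := E))) ?id = 1" for k
      unfolding trt by (intro prod.neutral) (auto simp: \<rho>s_def tr)
    have "mtrace I (tensor n (\<rho>s(k := A, k' := A))) ?id = 0"
      if "trace A = 0" "k' \<in> {..<n} - {k}" for k k' A
      unfolding trt using that by (intro prod_zero) auto
    then show "k' \<in> {..<n} - {k} \<Longrightarrow> mtrace I (tensor n (\<rho>s(k := S i, k' := S i))) ?id = 0"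
      "k' \<in> {..<n} - {k} \<Longrightarrow> mtrace I (tensor n (\<rho>s(k := T, k' := T))) ?id = 0" for k k' i
      by (simp_all add: tr)
  qed
  finally have trK: "(\<Sum>s\<in>I. K s s) = of_nat n" by simp
  have main: "2 * Re (mtrace I (dtensor n \<rho> ((1/2) *\<^sub>R (L ** \<rho> + \<rho> ** L))) (tensor n F))
       \<le> real n * Re (trace (\<rho> ** (L ** L))) * Re (mtrace I (tensor_power n \<rho>) (tensor n F))
          + Re (mtrace I K (tensor n F)) / real n"
    if L: "self_adjoint L" and tr0: "trace (\<rho> ** L) = 0" and F: "\<And>k. k < n \<Longrightarrow> nonneg (F k)" for L F
  proof -
    obtain s l where L: "L = pauli s l" using self_adjoint_pauliE[OF L] .
    \<comment> \<open>The mean-zero condition determines the scalar part of the score, and with it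
      the trace of \<rho> L^2 becomes \<open>g l l\<close>.\<close>
    have s: "s = - (a \<bullet> l)" using tr0 unfolding L \<rho> trace_pauli_mult of_real_eq_0_iff
      by simp
    define g where "g = (\<lambda>x y. x \<bullet> y - (a \<bullet> x) * (a \<bullet> y))"
    have R: "(1/2) *\<^sub>R (L ** \<rho> + \<rho> ** L) = pauli 0 ((1/2) *\<^sub>R (l - (a \<bullet> l) *\<^sub>R a))"
      unfolding L \<rho> pauli_anticommutator pauli_scaleR
      by (simp add: s pauli_inject inner_commute algebra_simps)
    have q: "Re (trace (\<rho> ** (L ** L))) = g l l"
      unfolding \<rho> L pauli_square by (simp add: trace_pauli_mult g_def s algebra_simps)
    have "\<exists>f v. F k = pauli f v \<and> norm v \<le> f" if "k < n" for k
      using F[OF that] nonneg_pauliE by metis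
    then obtain f v where F: "\<And>k. k < n \<Longrightarrow> F k = pauli (f k) (v k)"
      and v: "\<And>k. k < n \<Longrightarrow> norm (v k) \<le> f k" by metis
    define p where "p k = f k + a \<bullet> v k" for k
    define e where "e k = f k - a \<bullet> v k" for k
    have t1: "trace (\<rho> ** F k) = complex_of_real (p k)"
      "trace (E ** F k) = complex_of_real (e k)"
      "trace (S i ** F k) = complex_of_real (v k $ i)"
      "trace (T ** F k) = complex_of_real (a \<bullet> v k)"
      "trace (((1/2) *\<^sub>R (L ** \<rho> + \<rho> ** L)) ** F k) = complex_of_real (g l (v k))"
      if "k < n" for k i
      using that unfolding R
      by (simp_all add: F \<rho> E_def S_def T_def trace_pauli_mult p_def e_def g_def inner_axis' algebra_simps)
    have pr: "(\<Prod>j\<in>J. trace (\<rho> ** F j)) = complex_of_real (\<Prod>j\<in>J. p j)" if "J \<subseteq> {..<n}" for J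
      unfolding of_real_prod using that by (intro prod.cong) (auto simp: t1)
    have u1: "mtrace I (tensor n (\<rho>s(k := A))) (tensor n F)
        = trace (A ** F k) * complex_of_real (\<Prod>j\<in>{..<n}-{k}. p j)" if "k < n" for A k
      unfolding I_def mtrace_tensor \<rho>s_def
      by (subst prod_fun_upd_const[OF that, where f = "\<lambda>A k. trace (A ** F k)"]) (simp only: pr Diff_subset)
    have u2: "mtrace I (tensor n (\<rho>s(k := A, k' := A))) (tensor n F)
        = trace (A ** F k) * trace (A ** F k') * complex_of_real (\<Prod>j\<in>{..<n}-{k}-{k'}. p j)"
      if "k < n" "k' \<in> {..<n} - {k}" for A k k'
      unfolding I_def mtrace_tensor \<rho>s_def
      by (subst prod_fun_upd2_const[OF that, where f = "\<lambda>A k. trace (A ** F k)"], subst pr) auto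
    have 1: "mtrace I (dtensor n \<rho> ((1/2) *\<^sub>R (L ** \<rho> + \<rho> ** L))) (tensor n F)
       = complex_of_real (\<Sum>k<n. g l (v k) * (\<Prod>j\<in>{..<n}-{k}. p j))"
      unfolding dtensor_def mtrace_sum_left \<rho>s_def[symmetric] of_real_sum
      by (intro sum.cong refl) (simp only: lessThan_iff u1 t1 of_real_mult)
    have 2: "mtrace I (tensor_power n \<rho>) (tensor n F) = complex_of_real (\<Prod>j<n. p j)"
      unfolding I_def tensor_power_def mtrace_tensor by (rule pr) simp
    have g3: "(\<Sum>i\<in>UNIV. x $ i * y $ i) - (a \<bullet> x) * (a \<bullet> y) = g x y" for x y
      by (simp add: g_def inner_vec_def)
    have "mtrace I K (tensor n F) = (\<Sum>k<n. mtrace I (tensor n (\<rho>s(k := E))) (tensor n F)) +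
      (\<Sum>k<n. \<Sum>k'\<in>{..<n}-{k}. (\<Sum>i\<in>UNIV. mtrace I (tensor n (\<rho>s(k := S i, k' := S i))) (tensor n F))
        - mtrace I (tensor n (\<rho>s(k := T, k' := T))) (tensor n F))"
      unfolding mtrace_sum_left[symmetric] mtrace_diff_left[symmetric] mtrace_add_left[symmetric] K_def ..
    also have "\<dots> = complex_of_real ((\<Sum>k<n. e k * (\<Prod>j\<in>{..<n}-{k}. p j)) +
         (\<Sum>k<n. \<Sum>k'\<in>{..<n}-{k}. g (v k) (v k') * (\<Prod>j\<in>{..<n}-{k}-{k'}. p j)))"
      unfolding of_real_add of_real_sum
    proof (intro arg_cong2[where f = "(+)"] sum.cong refl)
      fix k assume "k \<in> {..<n}"
      then show "mtrace I (tensor n (\<rho>s(k := E))) (tensor n F) = complex_of_real (e k * (\<Prod>j\<in>{..<n}-{k}. p j))"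
        by (simp only: lessThan_iff u1 t1 of_real_mult)
    next
      fix k k' assume k: "k \<in> {..<n}" "k' \<in> {..<n}-{k}"
      then have k': "k' < n" by simp
      let ?P = "complex_of_real (\<Prod>j\<in>{..<n}-{k}-{k'}. p j)"
      have "(\<Sum>i\<in>UNIV. mtrace I (tensor n (\<rho>s(k := S i, k' := S i))) (tensor n F))
          - mtrace I (tensor n (\<rho>s(k := T, k' := T))) (tensor n F)
        = complex_of_real ((\<Sum>i\<in>UNIV. v k $ i * v k' $ i) - (a \<bullet> v k) * (a \<bullet> v k')) * ?P"
        using k k' by (simp only: lessThan_iff u2 t1 of_real_mult of_real_sum of_real_diff
            sum_distrib_right left_diff_distrib)
      then show "(\<Sum>i\<in>UNIV. mtrace I (tensor n (\<rho>s(k := S i, k' := S i))) (tensor n F))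
          - mtrace I (tensor n (\<rho>s(k := T, k' := T))) (tensor n F)
        = complex_of_real (g (v k) (v k') * (\<Prod>j\<in>{..<n}-{k}-{k'}. p j))"
        by (simp only: g3 of_real_mult)
    qed
    finally have 3: "mtrace I K (tensor n F) = complex_of_real ((\<Sum>k<n. e k * (\<Prod>j\<in>{..<n}-{k}. p j)) +
         (\<Sum>k<n. \<Sum>k'\<in>{..<n}-{k}. g (v k) (v k') * (\<Prod>j\<in>{..<n}-{k}-{k'}. p j)))" .
    have av: "\<bar>a \<bullet> v k\<bar> \<le> norm a * f k" if "k < n" for k
      using Cauchy_Schwarz_ineq2[of a "v k"] v[OF that] by (meson mult_left_mono norm_ge_zero order_trans)
    have f0: "0 \<le> f k" if "k < n" for k using v[OF that] norm_ge_zero order_trans by blast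
    show ?thesis unfolding 1 2 3 q Re_complex_of_real unfolding g_def
    proof (rule mixed_pointwise_bound[OF n])
      fix k assume k: "k < n"
      have "norm a * f k \<le> f k" using a f0[OF k] by (simp add: mult_left_le_one_le)
      then show "0 \<le> p k" using av[OF k] unfolding p_def by linarith
      show "v k = 0 \<and> e k = 0" if "p k = 0"
      proof -
        \<comment> \<open>Invertibility of the state enters here: since |a| < 1, an effect of
          probability 0 must be the zero matrix.\<close>
        have "f k \<le> norm a * f k" using that av[OF k] unfolding p_def by linarith
        then have "f k = 0" using a f0[OF k]
          by (metis mult.commute mult_le_cancel_left1 not_less order_antisym)
        then show ?thesis using v[OF k] by (simp add: e_def)
      qed
      \<comment> \<open>The product \<open>e k * p k\<close> is f^2 - (a . v)^2, so nonnegativity of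
        the factor is exactly what the diagonal bound requires; rank-one factors give
        equality.\<close>
      have "v k \<bullet> v k \<le> f k * f k"
        using power_mono[OF v[OF k] norm_ge_zero, of 2]
        unfolding power2_norm_eq_inner unfolding power2_eq_square .
      then show "v k \<bullet> v k - (a \<bullet> v k) * (a \<bullet> v k) \<le> e k * p k"
        by (simp add: e_def p_def algebra_simps)
    qed (use a in simp)
  qed
  show thesis
    by (rule that[of K]) (use trK main in \<open>simp_all add: I_def\<close>)
qed

text \<open>A trace against a fixed matrix is a finite linear combination of entries, so the
  entrywise integral representation carries over to it.\<close>

lemma product_form_mtrace:
  fixes Y :: "'y measure"
  assumes "product_form n Y N"
  obtains \<mu> :: "'y measure" and F where
    "\<And>x k. x \<in> space \<mu> \<Longrightarrow> k < n \<Longrightarrow> nonneg (F k x)"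
    "\<And>T A. A \<in> sets Y \<Longrightarrow>
       set_integrable \<mu> A (\<lambda>x. mtrace (copies_basis n) T (tensor n (\<lambda>k. F k x)))"
    "\<And>T A. A \<in> sets Y \<Longrightarrow> mtrace (copies_basis n) T (N A)
        = (LINT x:A|\<mu>. mtrace (copies_basis n) T (tensor n (\<lambda>k. F k x)))"
proof -
  obtain \<mu> :: "'y measure" and F where s: "sets \<mu> = sets Y"
    and F: "\<forall>k<n. F k \<in> borel_measurable \<mu> \<and> (\<forall>x\<in>space \<mu>. nonneg (F k x))"
    and N: "\<forall>A\<in>sets \<mu>. \<forall>s\<in>copies_basis n. \<forall>t\<in>copies_basis n.
        set_integrable \<mu> A (\<lambda>x. tensor n (\<lambda>k. F k x) s t) \<and>
        N A s t = (LINT x:A|\<mu>. tensor n (\<lambda>k. F k x) s t)"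
    using assms unfolding product_form_def by blast
  have i: "integrable \<mu> (\<lambda>x. indicator A x *\<^sub>R tensor n (\<lambda>k. F k x) s t)"
    "N A s t = integral\<^sup>L \<mu> (\<lambda>x. indicator A x *\<^sub>R tensor n (\<lambda>k. F k x) s t)"
    if "A \<in> sets Y" "s \<in> copies_basis n" "t \<in> copies_basis n" for A s t
    using N that unfolding s set_integrable_def set_lebesgue_integral_def by blast+
  have e: "indicator A x *\<^sub>R mtrace I T (tensor n (\<lambda>k. F k x))
      = (\<Sum>s\<in>I. \<Sum>t\<in>I. T s t * (indicator A x *\<^sub>R tensor n (\<lambda>k. F k x) t s))" for A x T and I :: "2 list set"
    unfolding mtrace_def scaleR_sum_right by (intro sum.cong refl) simp
  show thesis
  proof (rule that[of \<mu> F])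
    show "nonneg (F k x)" if "x \<in> space \<mu>" "k < n" for x k using F that by blast
    show "set_integrable \<mu> A (\<lambda>x. mtrace (copies_basis n) T (tensor n (\<lambda>k. F k x)))"
      if "A \<in> sets Y" for T A
      unfolding set_integrable_def e using that
      by (intro Bochner_Integration.integrable_sum integrable_mult_right i(1)) auto
    show "mtrace (copies_basis n) T (N A) = (LINT x:A|\<mu>. mtrace (copies_basis n) T (tensor n (\<lambda>k. F k x)))"
      if "A \<in> sets Y" for T A
    proof -
      have it: "integrable \<mu> (\<lambda>x. T r u * (indicator A x *\<^sub>R tensor n (\<lambda>k. F k x) u r))"
        if "r \<in> copies_basis n" "u \<in> copies_basis n" for r u
        using that \<open>A \<in> sets Y\<close> by (intro integrable_mult_right i(1))
      have "(LINT x:A|\<mu>. mtrace (copies_basis n) T (tensor n (\<lambda>k. F k x)))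
        = (\<Sum>r\<in>copies_basis n. \<Sum>u\<in>copies_basis n.
            integral\<^sup>L \<mu> (\<lambda>x. T r u * (indicator A x *\<^sub>R tensor n (\<lambda>k. F k x) u r)))"
        unfolding set_lebesgue_integral_def e
        by (simp only: Bochner_Integration.integral_sum it Bochner_Integration.integrable_sum cong: sum.cong)
      also have "\<dots> = mtrace (copies_basis n) T (N A)"
        unfolding mtrace_def integral_mult_right_zero
        by (intro sum.cong refl) (simp only: i(2)[OF that])
      finally show ?thesis ..
    qed
  qed
qed

text \<open>The order of quantifiers matters: \<open>K\<close> is fixed before \<open>L\<close> and
  \<open>A\<close>. When the inequality is summed over a partition, each event may use its own
  score, while the \<open>K\<close>-terms still add up to 1.\<close>

definition information_majorant ::
  "nat \<Rightarrow> complex^2^2 \<Rightarrow> 'x measure \<Rightarrow> ('x set \<Rightarrow> 2 list \<Rightarrow> 2 list \<Rightarrow> complex) \<Rightarrow>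
    (2 list \<Rightarrow> 2 list \<Rightarrow> complex) \<Rightarrow> bool" where
  "information_majorant n \<rho> X M K \<longleftrightarrow>
    Re (\<Sum>s\<in>copies_basis n. K s s) = real n \<and>
    (\<forall>L. \<forall>A\<in>sets X. self_adjoint L \<longrightarrow> trace (\<rho> ** L) = 0 \<longrightarrow>
      2 * Re (mtrace (copies_basis n) (dtensor n \<rho> ((1/2) *\<^sub>R (L ** \<rho> + \<rho> ** L))) (M A))
       \<le> real n * Re (trace (\<rho> ** (L ** L))) * Re (mtrace (copies_basis n) (tensor_power n \<rho>) (M A))
          + Re (mtrace (copies_basis n) K (M A)) / real n)"

lemma information_majorant_pure:
  assumes n: "n \<ge> 1" and a: "norm a = 1" and M: "measurement (copies_basis n) X M"
  shows "\<exists>K. information_majorant n (bloch_state a) X M K"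
proof -
  have "norm ((1/2) *\<^sub>R a) = 1/2" using a by simp
  then obtain b where b: "\<And>i j. bloch_state a $ i $ j = b i * cnj (b j)"
    unfolding bloch_state_pauli
    using pauli_factorization[of "(1/2) *\<^sub>R a" "1/2"] by (metis add.right_neutral mult_zero_left order_refl)
  have "trace (bloch_state a) = 1" by (simp add: bloch_state_pauli trace_pauli)
  then have u: "b 1 * cnj (b 1) + b 2 * cnj (b 2) = 1" by (simp add: trace_def sum_2 b)
  obtain K where trK: "Re (\<Sum>s\<in>copies_basis n. K s s) = real n"
    and K: "\<And>L M. self_adjoint L \<Longrightarrow> trace (bloch_state a ** L) = 0 \<Longrightarrow> nonneg_on (copies_basis n) M \<Longrightarrow>
      2 * Re (mtrace (copies_basis n) (dtensor n (bloch_state a) ((1/2) *\<^sub>R (L ** bloch_state a + bloch_state a ** L))) M)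
       \<le> real n * Re (trace (bloch_state a ** (L ** L))) * Re (mtrace (copies_basis n) (tensor_power n (bloch_state a)) M)
          + Re (mtrace (copies_basis n) K M) / real n"
    by (rule pure_information_bound[OF n u b]) blast
  show ?thesis
    unfolding information_majorant_def
  proof (intro exI[of _ K] conjI allI ballI impI)
    fix A assume "A \<in> sets X"
    then have "nonneg_on (copies_basis n) (M A)" using M by (auto simp: measurement_def)
    from K[OF _ _ this] show "2 * Re (mtrace (copies_basis n) (dtensor n (bloch_state a)
        ((1/2) *\<^sub>R (L ** bloch_state a + bloch_state a ** L))) (M A))
       \<le> real n * Re (trace (bloch_state a ** (L ** L)))
            * Re (mtrace (copies_basis n) (tensor_power n (bloch_state a)) (M A))
          + Re (mtrace (copies_basis n) K (M A)) / real n"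
      if "self_adjoint L" "trace (bloch_state a ** L) = 0" for L using that .
  qed (rule trK)
qed

text \<open>The bound holds for the product operator at every outcome of the refinement and is
  linear in it, so it can be integrated over the preimage of an event of \<open>M\<close>.\<close>

lemma information_majorant_mixed:
  assumes n: "n \<ge> 1" and a: "norm a < 1"
    and N: "product_form n Y N" and ref: "refinement (copies_basis n) Y N X M"
  shows "\<exists>K. information_majorant n (bloch_state a) X M K"
proof -
  define I where "I = copies_basis n"
  define \<rho> where "\<rho> = bloch_state a"
  obtain K where trK: "Re (\<Sum>s\<in>I. K s s) = real n"
    and K: "\<And>L F. self_adjoint L \<Longrightarrow> trace (\<rho> ** L) = 0 \<Longrightarrow> (\<And>k. k < n \<Longrightarrow> nonneg (F k)) \<Longrightarrow>
      2 * Re (mtrace I (dtensor n \<rho> ((1/2) *\<^sub>R (L ** \<rho> + \<rho> ** L))) (tensor n F))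
       \<le> real n * Re (trace (\<rho> ** (L ** L))) * Re (mtrace I (tensor_power n \<rho>) (tensor n F))
          + Re (mtrace I K (tensor n F)) / real n"
    unfolding I_def \<rho>_def by (rule mixed_information_bound[OF n a]) blast
  obtain \<mu> F where F: "\<And>x k. x \<in> space \<mu> \<Longrightarrow> k < n \<Longrightarrow> nonneg (F k x)"
    and int: "\<And>T A. A \<in> sets Y \<Longrightarrow> set_integrable \<mu> A (\<lambda>x. mtrace I T (tensor n (\<lambda>k. F k x)))"
    and eq: "\<And>T A. A \<in> sets Y \<Longrightarrow> mtrace I T (N A) = (LINT x:A|\<mu>. mtrace I T (tensor n (\<lambda>k. F k x)))"
    unfolding I_def by (rule product_form_mtrace[OF N]) blast
  obtain f where f: "f \<in> Y \<rightarrow>\<^sub>M X"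
    and MN: "\<forall>B\<in>sets X. \<forall>i\<in>I. \<forall>j\<in>I. M B i j = N (f -` B \<inter> space Y) i j"
    using ref unfolding refinement_def I_def by blast
  have "2 * Re (mtrace I (dtensor n \<rho> ((1/2) *\<^sub>R (L ** \<rho> + \<rho> ** L))) (M A))
       \<le> real n * Re (trace (\<rho> ** (L ** L))) * Re (mtrace I (tensor_power n \<rho>) (M A))
          + Re (mtrace I K (M A)) / real n"
    if A: "A \<in> sets X" and L: "self_adjoint L" "trace (\<rho> ** L) = 0" for A L
  proof -
    define B where "B = f -` A \<inter> space Y"
    have B: "B \<in> sets Y" unfolding B_def using f A by (rule measurable_sets)
    have MB: "mtrace I T (M A) = mtrace I T (N B)" for T
      unfolding B_def by (intro mtrace_cong) (use MN A in auto)
    define m where "m T x = indicator B x *\<^sub>R mtrace I T (tensor n (\<lambda>k. F k x))" for T x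
    have m: "integrable \<mu> (m T)" for T using int[OF B] unfolding set_integrable_def m_def .
    have Nm: "Re (mtrace I T (M A)) = integral\<^sup>L \<mu> (\<lambda>x. Re (m T x))" for T
      unfolding MB eq[OF B] set_lebesgue_integral_def m_def[symmetric] by (simp add: m)
    let ?R = "dtensor n \<rho> ((1/2) *\<^sub>R (L ** \<rho> + \<rho> ** L))" and ?P = "tensor_power n \<rho>"
    let ?q = "real n * Re (trace (\<rho> ** (L ** L)))"
    have mR: "integrable \<mu> (\<lambda>x. Re (m T x))" for T using m by simp
    have "0 \<le> integral\<^sup>L \<mu> (\<lambda>x. ?q * Re (m ?P x) + Re (m K x) / real n - 2 * Re (m ?R x))"
    proof (rule Bochner_Integration.integral_nonneg)
      fix x assume "x \<in> space \<mu>"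
      then show "0 \<le> ?q * Re (m ?P x) + Re (m K x) / real n - 2 * Re (m ?R x)"
        using K[OF L, of "\<lambda>k. F k x"] F by (cases "x \<in> B") (simp_all add: m_def)
    qed
    also have "\<dots> = ?q * integral\<^sup>L \<mu> (\<lambda>x. Re (m ?P x)) + integral\<^sup>L \<mu> (\<lambda>x. Re (m K x)) / real n
        - 2 * integral\<^sup>L \<mu> (\<lambda>x. Re (m ?R x))"
      using mR by (simp del: integral_Re)
    finally show ?thesis unfolding Nm by simp
  qed
  then show ?thesis
    using trK unfolding information_majorant_def I_def[symmetric] \<rho>_def[symmetric]
    by (intro exI[of _ K]) simp
qed

section \<open>Existence of quantum scores and the quadratic form of the information matrix\<close>

lemma has_partial_derivative_axis:
  assumes "(f has_derivative D) (at \<theta>)"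
  shows "has_partial_derivative f (D (axis i 1)) i \<theta>"
proof -
  have "((\<lambda>t. \<theta> + t *\<^sub>R axis i 1) has_derivative (\<lambda>t. t *\<^sub>R axis i 1)) (at 0)"
    by (auto intro!: derivative_eq_intros)
  from diff_chain_at[OF this, of f D] assms
  have "((\<lambda>t. f (\<theta> + t *\<^sub>R axis i 1)) has_derivative (\<lambda>t. D (t *\<^sub>R axis i 1))) (at 0)"
    by (simp add: o_def)
  moreover have "D (t *\<^sub>R axis i 1) = t *\<^sub>R D (axis i 1)" for t
    using assms by (simp add: has_derivative_def bounded_linear.linear linear_scale)
  ultimately show ?thesis unfolding has_partial_derivative_def has_vector_derivative_def by simp
qed

text \<open>\<open>quantum_score\<close> is a choice term, so a solution must be exhibited before
  anything is known about it. In Bloch coordinates the score equation is a linear system in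
  \<open>s\<close> and \<open>l\<close>. Its scalar component, which says that the derivative is
  traceless, is also the mean-zero property.\<close>

lemma is_quantum_score_quantum_score:
  fixes \<rho> :: "real^'p \<Rightarrow> complex^2^2"
  assumes \<Theta>: "open \<Theta>" "\<theta> \<in> \<Theta>" and D: "(\<rho> has_derivative D) (at \<theta>)"
    and model: "pure_state_model \<Theta> \<rho> \<or> mixed_state_model \<Theta> \<rho>"
  shows "is_quantum_score \<rho> \<theta> i (quantum_score \<rho> \<theta> i)"
    and "D (axis i 1) = (1/2) *\<^sub>R (quantum_score \<rho> \<theta> i ** \<rho> \<theta> + \<rho> \<theta> ** quantum_score \<rho> \<theta> i)"
    and "trace (\<rho> \<theta> ** quantum_score \<rho> \<theta> i) = 0"
proof -
  define w where "w \<theta> = pauli_vec (\<rho> \<theta>)" for \<theta>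
  define h where "h = (axis i 1 :: real^'p)"
  define b where "b = 2 *\<^sub>R pauli_vec (D h)"
  define a where "a = 2 *\<^sub>R w \<theta>"
  have bloch: "\<exists>a. \<rho> \<theta>' = bloch_state a" if "\<theta>' \<in> \<Theta>" for \<theta>'
    using model that unfolding pure_state_model_def mixed_state_model_def by blast
  have \<rho>w: "\<rho> \<theta>' = pauli (1/2) 0 + pauli 0 (w \<theta>')" if "\<theta>' \<in> \<Theta>" for \<theta>'
    using bloch[OF that] by (auto simp: w_def bloch_state_pauli pauli_vec_pauli pauli_add)
  have \<rho>a: "\<rho> \<theta> = pauli (1/2) ((1/2) *\<^sub>R a)" using \<rho>w[OF \<Theta>(2)] by (simp add: pauli_add a_def)
  have wD: "(w has_derivative (\<lambda>h. pauli_vec (D h))) (at \<theta>)"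
    unfolding w_def by (rule bounded_linear.has_derivative[OF bounded_linear_pauli_vec D])
  \<comment> \<open>The trace is constantly 1 near \<theta>, so the derivative has no scalar part;
    openness of \<open>\<Theta>\<close> is used to differentiate this identity.\<close>
  have "((\<lambda>\<theta>. pauli (1/2) 0 + pauli 0 (w \<theta>)) has_derivative (\<lambda>h. pauli 0 (pauli_vec (D h)))) (at \<theta>)"
    using has_derivative_add[OF has_derivative_const bounded_linear.has_derivative[OF bounded_linear_pauli0 wD]]
    by simp
  then have "(\<rho> has_derivative (\<lambda>h. pauli 0 (pauli_vec (D h)))) (at \<theta>)"
    by (rule has_derivative_transform_within_open[OF _ \<Theta>]) (simp add: \<rho>w)
  then have "D = (\<lambda>h. pauli 0 (pauli_vec (D h)))" using D by (rule has_derivative_unique[rotated])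
  then have "D h = pauli 0 (pauli_vec (D h))" by (rule fun_cong)
  also have "pauli_vec (D h) = (1/2) *\<^sub>R b" by (simp add: b_def)
  finally have Dh: "D h = pauli 0 ((1/2) *\<^sub>R b)" .
  have anti: "(1/2) *\<^sub>R (pauli s l ** \<rho> \<theta> + \<rho> \<theta> ** pauli s l)
      = pauli ((s + l \<bullet> a) / 2) ((1/2) *\<^sub>R (s *\<^sub>R a + l))" for s l
    unfolding \<rho>a pauli_anticommutator pauli_scaleR pauli_inject
    by (simp add: scaleR_right_distrib add_divide_distrib)
  have "\<exists>s l. s + l \<bullet> a = 0 \<and> s *\<^sub>R a + l = b"
    using model
  proof
    assume pure: "pure_state_model \<Theta> \<rho>"
    \<comment> \<open>Pure states stay on a sphere, so the derivative \<open>b\<close> is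
      tangential, orthogonal to \<open>a\<close>, and \<open>l = b\<close> with no scalar part
      solves the system.\<close>
    have "w \<theta>' \<bullet> w \<theta>' = 1/4" if "\<theta>' \<in> \<Theta>" for \<theta>'
    proof -
      have "\<exists>u. \<rho> \<theta>' = bloch_state u \<and> norm u = 1"
        using pure that by (simp only: pure_state_model_def)
      then obtain u where "\<rho> \<theta>' = bloch_state u" and u: "norm u = 1" by blast
      then have w: "w \<theta>' = (1/2) *\<^sub>R u"
        by (simp only: w_def bloch_state_pauli pauli_vec_pauli)
      have "u \<bullet> u = 1" using u by (simp only: norm_eq_1)
      then show ?thesis unfolding w by simp
    qed
    then have "((\<lambda>\<theta>'. w \<theta>' \<bullet> w \<theta>') has_derivative (\<lambda>h. 0)) (at \<theta>)"
      by (intro has_derivative_transform_within_open[OF has_derivative_const[of "1/4"] \<Theta>]) simp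
    moreover have "((\<lambda>\<theta>'. w \<theta>' \<bullet> w \<theta>') has_derivative
        (\<lambda>h. w \<theta> \<bullet> pauli_vec (D h) + pauli_vec (D h) \<bullet> w \<theta>)) (at \<theta>)"
      by (rule has_derivative_inner[OF wD wD])
    ultimately have "(\<lambda>h. w \<theta> \<bullet> pauli_vec (D h) + pauli_vec (D h) \<bullet> w \<theta>) = (\<lambda>h. 0)"
      by (rule has_derivative_unique[rotated])
    then have "w \<theta> \<bullet> pauli_vec (D h) + pauli_vec (D h) \<bullet> w \<theta> = 0" by (rule fun_cong)
    then have "b \<bullet> a = 0" by (simp add: a_def b_def inner_commute)
    then show ?thesis by (intro exI[of _ 0] exI[of _ b]) simp
  next
    assume mixed: "mixed_state_model \<Theta> \<rho>"
    obtain a' where "\<rho> \<theta> = bloch_state a'" "norm a' < 1"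
      using mixed \<Theta> unfolding mixed_state_model_def by blast
    then have "norm a < 1" by (simp add: a_def w_def bloch_state_pauli pauli_vec_pauli)
    then have "(norm a)\<^sup>2 < 1" by (simp add: abs_square_less_1)
    then have ne: "1 - a \<bullet> a \<noteq> 0" by (simp add: power2_norm_eq_inner)
    \<comment> \<open>Eliminating \<open>l = b - s a\<close> leaves one scalar equation for
      \<open>s\<close>, solvable because |a| < 1; \<open>c\<close> is -s.\<close>
    define c where "c = (b \<bullet> a) / (1 - a \<bullet> a)"
    have "c * (1 - a \<bullet> a) = b \<bullet> a" unfolding c_def using ne by simp
    then show ?thesis
      by (intro exI[of _ "- c"] exI[of _ "b + c *\<^sub>R a"]) (simp add: algebra_simps)
  qed
  then obtain s l where sl: "s + l \<bullet> a = 0" "s *\<^sub>R a + l = b" by blast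
  have "is_quantum_score \<rho> \<theta> i (pauli s l)"
    unfolding is_quantum_score_def anti sl
    using has_partial_derivative_axis[OF D, of i] self_adjoint_pauli Dh
    by (simp add: h_def)
  then show score: "is_quantum_score \<rho> \<theta> i (quantum_score \<rho> \<theta> i)"
    unfolding quantum_score_def by (rule someI)
  let ?L = "quantum_score \<rho> \<theta> i"
  show DL: "D (axis i 1) = (1/2) *\<^sub>R (?L ** \<rho> \<theta> + \<rho> \<theta> ** ?L)"
    using has_partial_derivative_axis[OF D, of i] score
    unfolding is_quantum_score_def has_partial_derivative_def by (metis vector_derivative_unique_at)
  obtain s l where L: "?L = pauli s l"
    using score self_adjoint_pauliE unfolding is_quantum_score_def by metis
  have "s + l \<bullet> a = 0" using DL Dh unfolding L anti h_def[symmetric] by (simp add: pauli_inject)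
  then show "trace (\<rho> \<theta> ** ?L) = 0" unfolding L \<rho>a by (simp add: trace_pauli_mult inner_commute)
qed

lemma trace_scaleR: "trace (c *\<^sub>R A) = c *\<^sub>R trace A"
  for A :: "'a::real_algebra_1^'d^'d"
  by (simp add: trace_def scaleR_sum_right)

lemma matrix_add_rdistrib: "(A + B) ** C = A ** C + B ** C"
  for A B :: "'a::semiring_1^'e^'d"
  by (simp add: matrix_matrix_mult_def vec_eq_iff sum.distrib distrib_right)

lemma bilinear_Re_trace: "bilinear (\<lambda>x y. Re (trace (\<rho> ** (x ** y))))"
  for \<rho> :: "complex^'d^'d"
  unfolding bilinear_def
  by (intro conjI allI linearI)
     (simp_all add: matrix_add_ldistrib matrix_add_rdistrib trace_add trace_scaleR
        matrix_scalar_ac flip: scalar_matrix_assoc)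

text \<open>The trace form is bilinear in the two scores, and the symmetrization in the information
  matrix disappears on the diagonal.\<close>

lemma quantum_information_quadratic_form:
  "h \<bullet> (quantum_information \<rho> \<theta> *v h)
    = Re (trace (\<rho> \<theta> ** ((\<Sum>i\<in>UNIV. (h $ i) *\<^sub>R quantum_score \<rho> \<theta> i) **
        (\<Sum>i\<in>UNIV. (h $ i) *\<^sub>R quantum_score \<rho> \<theta> i))))"
proof -
  define B where "B x y = Re (trace (\<rho> \<theta> ** (x ** y)))" for x y :: "complex^2^2"
  define l where "l = quantum_score \<rho> \<theta>"
  have B: "bilinear B" unfolding B_def by (rule bilinear_Re_trace)
  have IQ: "quantum_information \<rho> \<theta> $ i $ j = (B (l i) (l j) + B (l j) (l i)) / 2" for i j
    by (simp add: quantum_information_def B_def l_def matrix_add_ldistrib trace_add)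
  have "B (\<Sum>i\<in>UNIV. (h $ i) *\<^sub>R l i) (\<Sum>i\<in>UNIV. (h $ i) *\<^sub>R l i)
      = (\<Sum>i\<in>UNIV. \<Sum>j\<in>UNIV. h $ i * h $ j * B (l i) (l j))"
    unfolding bilinear_sum[OF B] sum.cartesian_product[symmetric]
    by (simp add: bilinear_lmul[OF B] bilinear_rmul[OF B] mult_ac)
  moreover have "(\<Sum>i\<in>UNIV. \<Sum>j\<in>UNIV. h $ i * h $ j * B (l i) (l j))
      = (\<Sum>i\<in>UNIV. \<Sum>j\<in>UNIV. h $ i * h $ j * B (l j) (l i))"
    by (subst sum.swap) (simp only: mult_ac)
  moreover have "h \<bullet> (quantum_information \<rho> \<theta> *v h)
      = (\<Sum>i\<in>UNIV. \<Sum>j\<in>UNIV. h $ i * h $ j * B (l i) (l j)) / 2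
       + (\<Sum>i\<in>UNIV. \<Sum>j\<in>UNIV. h $ i * h $ j * B (l j) (l i)) / 2"
    unfolding inner_vec_def matrix_vector_mult_def IQ sum_divide_distrib sum.distrib[symmetric]
    by (simp add: sum_distrib_left field_simps)
  ultimately show ?thesis unfolding B_def l_def by simp
qed

lemma self_adjoint_sum_scaleR:
  assumes "\<And>i. i \<in> J \<Longrightarrow> self_adjoint (l i)"
  shows "self_adjoint (\<Sum>i\<in>J. c i *\<^sub>R l i)"
  unfolding self_adjoint_on_def
proof (intro ballI)
  fix i j
  have h: "l k $ j $ i = cnj (l k $ i $ j)" if "k \<in> J" for k
    using assms[OF that] unfolding self_adjoint_on_def by blast
  show "(\<Sum>k\<in>J. c k *\<^sub>R l k) $ j $ i = cnj ((\<Sum>k\<in>J. c k *\<^sub>R l k) $ i $ j)"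
    unfolding sum_component vector_scaleR_component cnj_sum complex_cnj_scaleR
    by (intro sum.cong refl) (simp only: h[symmetric])
qed

text \<open>The score equation is linear, so the score in direction \<open>h\<close> is the
  combination of the coordinate scores with weights \<open>h $ i\<close>. It is self-adjoint with
  mean zero, as the majorant demands.\<close>

lemma information_inequality:
  fixes \<rho> :: "real^'p \<Rightarrow> complex^2^2"
  assumes \<Theta>: "open \<Theta>" "\<theta> \<in> \<Theta>" and D: "(\<rho> has_derivative D) (at \<theta>)"
    and model: "pure_state_model \<Theta> \<rho> \<or> mixed_state_model \<Theta> \<rho>"
    and n: "n \<ge> 1" and M: "measurement (copies_basis n) X M"
    and refinable: "mixed_state_model \<Theta> \<rho> \<Longrightarrow> \<exists>(Y :: 'y measure) N.
            refinement (copies_basis n) Y N X M \<and> product_form n Y N"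
  obtains K where "Re (\<Sum>s\<in>copies_basis n. K s s) = real n"
    "\<And>h A. A \<in> sets X \<Longrightarrow>
      2 * Re (mtrace (copies_basis n) (dtensor n (\<rho> \<theta>) (D h)) (M A))
       \<le> real n * (h \<bullet> (quantum_information \<rho> \<theta> *v h))
            * Re (mtrace (copies_basis n) (tensor_power n (\<rho> \<theta>)) (M A))
          + Re (mtrace (copies_basis n) K (M A)) / real n"
proof -
  have "\<exists>K. information_majorant n (\<rho> \<theta>) X M K"
    using model
  proof
    assume "pure_state_model \<Theta> \<rho>"
    then show ?thesis using \<Theta> information_majorant_pure[OF n _ M] unfolding pure_state_model_def by metis
  next
    assume m: "mixed_state_model \<Theta> \<rho>"
    then show ?thesis
      using \<Theta> information_majorant_mixed[OF n] refinable[OF m] unfolding mixed_state_model_def by metis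
  qed
  then obtain K where K: "information_majorant n (\<rho> \<theta>) X M K" by blast
  note score = is_quantum_score_quantum_score[OF \<Theta> D model]
  show thesis
  proof (rule that[of K])
    show "Re (\<Sum>s\<in>copies_basis n. K s s) = real n" using K by (simp add: information_majorant_def)
    fix h :: "real^'p" and A assume A: "A \<in> sets X"
    let ?L = "\<Sum>i\<in>UNIV. (h $ i) *\<^sub>R quantum_score \<rho> \<theta> i"
    have sa: "self_adjoint ?L"
      by (rule self_adjoint_sum_scaleR) (use score(1) in \<open>simp add: is_quantum_score_def\<close>)
    have lin: "linear D" using D has_derivative_linear by blast
    have lin1: "linear (\<lambda>x. (1/2) *\<^sub>R (x ** \<rho> \<theta> + \<rho> \<theta> ** x))" "linear (\<lambda>x. trace (\<rho> \<theta> ** x))"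
      by (intro linearI; simp add: matrix_add_ldistrib matrix_add_rdistrib trace_add trace_scaleR
          matrix_scalar_ac scaleR_right_distrib algebra_simps flip: scalar_matrix_assoc)+
    have "D h = D (\<Sum>i\<in>UNIV. (h $ i) *\<^sub>R axis i 1)"
      using basis_expansion[of h] by (simp add: scalar_mult_eq_scaleR)
    also have "\<dots> = (\<Sum>i\<in>UNIV. (h $ i) *\<^sub>R ((1/2) *\<^sub>R (quantum_score \<rho> \<theta> i ** \<rho> \<theta> + \<rho> \<theta> ** quantum_score \<rho> \<theta> i)))"
      by (simp add: linear_sum[OF lin] linear_scale[OF lin] score(2))
    also have "\<dots> = (1/2) *\<^sub>R (?L ** \<rho> \<theta> + \<rho> \<theta> ** ?L)"
      unfolding linear_sum[OF lin1(1)] linear_scale[OF lin1(1)] ..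
    finally have Dh: "D h = (1/2) *\<^sub>R (?L ** \<rho> \<theta> + \<rho> \<theta> ** ?L)" .
    have tr: "trace (\<rho> \<theta> ** ?L) = 0"
      unfolding linear_sum[OF lin1(2)] linear_scale[OF lin1(2)] by (simp add: score(3))
    show "2 * Re (mtrace (copies_basis n) (dtensor n (\<rho> \<theta>) (D h)) (M A))
       \<le> real n * (h \<bullet> (quantum_information \<rho> \<theta> *v h))
            * Re (mtrace (copies_basis n) (tensor_power n (\<rho> \<theta>)) (M A))
          + Re (mtrace (copies_basis n) K (M A)) / real n"
      using K sa tr A unfolding information_majorant_def Dh quantum_information_quadratic_form by blast
  qed
qed

section \<open>Outcome distributions and rounding of estimators\<close>

lemma tensor_power_decomposition:
  assumes "\<And>i j. \<rho> $ i $ j = (\<Sum>k\<in>UNIV. B k i * cnj (B k j))"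
  shows "tensor_power n \<rho> s t
    = (\<Sum>u\<in>copies_basis n. (\<Prod>j<n. B (u ! j) (s ! j)) * cnj (\<Prod>j<n. B (u ! j) (t ! j)))"
  unfolding tensor_power_def tensor_def assms cnj_prod prod.distrib[symmetric]
  by (rule sum_copies_basis_prod[symmetric])

text \<open>A tensor power of a sum of rank-one matrices is again such a sum, so the trace is a sum
  of values of the quadratic form of \<open>M\<close>.\<close>

lemma mtrace_tensor_power_nonneg:
  assumes a: "norm a \<le> 1" and M: "nonneg_on (copies_basis n) M"
  shows "0 \<le> Re (mtrace (copies_basis n) (tensor_power n (bloch_state a)) M)"
proof -
  let ?I = "copies_basis n"
  have "norm ((1/2) *\<^sub>R a) \<le> 1/2" using a by simp
  then obtain b c :: "2 \<Rightarrow> complex" where bc: "\<And>i j. bloch_state a $ i $ j = b i * cnj (b j) + c i * cnj (c j)"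
    unfolding bloch_state_pauli using pauli_factorization by metis
  define B where "B k = (if k = 1 then b else c)" for k :: 2
  define v where "v u s = (\<Prod>j<n. B (u ! j) (s ! j))" for u s
  have B: "bloch_state a $ i $ j = (\<Sum>k\<in>UNIV. B k i * cnj (B k j))" for i j
    by (simp add: bc sum_2 B_def)
  have "mtrace ?I (tensor_power n (bloch_state a)) M
      = mtrace ?I (\<lambda>s t. \<Sum>u\<in>?I. v u s * cnj (v u t)) M"
    unfolding v_def by (intro arg_cong[where f = "\<lambda>T. mtrace ?I T M"] ext tensor_power_decomposition B)
  also have "\<dots> = (\<Sum>u\<in>?I. \<Sum>t\<in>?I. \<Sum>s\<in>?I. cnj (v u t) * M t s * v u s)"
    unfolding mtrace_sum_left
  proof (intro sum.cong refl)
    show "mtrace ?I (\<lambda>s t. v u s * cnj (v u t)) M = (\<Sum>t\<in>?I. \<Sum>s\<in>?I. cnj (v u t) * M t s * v u s)" for u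
      unfolding mtrace_def by (subst sum.swap) (simp add: mult_ac)
  qed
  also have "0 \<le> Re \<dots>"
    unfolding Re_sum[of "\<lambda>u. \<Sum>t\<in>?I. \<Sum>s\<in>?I. cnj (v u t) * M t s * v u s"]
    using M unfolding nonneg_on_def by (intro sum_nonneg) blast
  finally show ?thesis .
qed

text \<open>\<open>measure_of\<close> yields the zero measure unless its set function is a measure,
  so positivity and countable additivity must be proved before Born's rule can be read off.\<close>

lemma copies_distribution:
  assumes a: "norm a \<le> 1" and M: "measurement (copies_basis n) X M"
  defines "P \<equiv> copies_distribution n (bloch_state a) X M"
  shows "sets P = sets X" "space P = space X" "finite_measure P" "measure P (space P) = 1"
    "\<And>A. A \<in> sets X \<Longrightarrow>
      measure P A = Re (mtrace (copies_basis n) (tensor_power n (bloch_state a)) (M A))"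
proof -
  let ?I = "copies_basis n"
  define m where "m A = Re (mtrace ?I (tensor_power n (bloch_state a)) (M A))" for A
  have P: "P = measure_of (space X) (sets X) (\<lambda>A. ennreal (m A))"
    unfolding P_def outcome_distribution_def m_def mtrace_def ..
  show sets: "sets P = sets X" unfolding P by simp
  show space: "space P = space X" unfolding P by (simp add: space_measure_of_conv)
  have pos: "0 \<le> m A" if "A \<in> sets X" for A
    unfolding m_def using M that by (intro mtrace_tensor_power_nonneg[OF a]) (auto simp: measurement_def)
  have "m {} = 0"
    unfolding m_def mtrace_def by (simp add: measurement_empty[OF M])
  have "emeasure P A = ennreal (m A)" if "A \<in> sets X" for A
    unfolding P
  proof (rule emeasure_measure_of_sigma)
    show "sigma_algebra (space X) (sets X)" by (rule sets.sigma_algebra_axioms)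
    show "positive (sets X) (\<lambda>A. ennreal (m A))" using \<open>m {} = 0\<close> by (simp add: positive_def)
    show "countably_additive (sets X) (\<lambda>A. ennreal (m A))"
    proof (unfold countably_additive_def, intro allI impI)
      fix A :: "nat \<Rightarrow> _" assume A: "range A \<subseteq> sets X" "disjoint_family A"
      have "(\<lambda>k. m (A k)) sums m (\<Union>k. A k)"
        unfolding m_def mtrace_def
        by (intro sums_Re sums_sum sums_mult measurement_sums[OF M] A) auto
      then show "(\<Sum>k. ennreal (m (A k))) = ennreal (m (\<Union>k. A k))"
        using A by (intro suminf_ennreal_eq pos) auto
    qed
  qed (use that in simp)
  then have em: "emeasure P A = ennreal (m A)" if "A \<in> sets X" for A using that .
  show "measure P A = Re (mtrace ?I (tensor_power n (bloch_state a)) (M A))" if "A \<in> sets X" for A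
    using em[OF that] pos[OF that] unfolding measure_def m_def by simp
  have "mtrace ?I (tensor_power n (bloch_state a)) (M (space X)) = (\<Sum>s\<in>?I. tensor_power n (bloch_state a) s s)"
    using M unfolding mtrace_identity[OF finite_copies_basis, symmetric]
    by (intro mtrace_cong) (auto simp: measurement_def)
  also have "\<dots> = 1"
    unfolding tensor_power_def trace_tensor by (simp add: bloch_state_pauli trace_pauli)
  finally have "m (space X) = 1" by (simp add: m_def)
  then show "finite_measure P" "measure P (space P) = 1"
    by (auto intro!: finite_measureI simp: space em measure_def)
qed

lemma borel_measurable_cover_rounding:
  fixes z :: "'a::euclidean_space"
  assumes "finite C"
  shows "\<exists>g \<in> borel_measurable borel. finite (range g) \<and>
    (\<forall>y. (y \<in> (\<Union>c\<in>C. ball c d) \<longrightarrow> dist (g y) y < d) \<and> (y \<notin> (\<Union>c\<in>C. ball c d) \<longrightarrow> g y = z))"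
  using assms
proof induction
  case empty
  show ?case by (intro bexI[of _ "\<lambda>_. z"]) auto
next
  case (insert c C)
  then obtain g where g: "g \<in> borel_measurable borel" "finite (range g)"
    "\<forall>y. (y \<in> (\<Union>c\<in>C. ball c d) \<longrightarrow> dist (g y) y < d) \<and> (y \<notin> (\<Union>c\<in>C. ball c d) \<longrightarrow> g y = z)"
    by blast
  let ?g = "\<lambda>y. if y \<in> ball c d then c else g y"
  have "?g \<in> borel_measurable borel" using g(1) by (intro measurable_If_set) auto
  moreover have "finite (range ?g)"
    by (rule finite_subset[of _ "insert c (range g)"]) (use g(2) in auto)
  ultimately show ?case using g(3) by (intro bexI[of _ ?g]) auto
qed

text \<open>The loss need only not increase by more than \<open>\<eta>\<close>, uniformly for
  \<open>x\<close> in the ball. On a large ball uniform continuity gives this; farther out every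
  value is replaced by \<open>x0\<close>, whose loss is already below that of any distant
  point.\<close>

lemma coercive_rounding:
  fixes q :: "'a::euclidean_space \<Rightarrow> real"
  assumes q: "continuous_on UNIV q" and "\<epsilon> > 0" and coer: "\<And>z. \<epsilon> * (norm z)\<^sup>2 \<le> q z"
    and "\<eta> > 0" "r \<ge> 0"
  obtains g where "g \<in> borel_measurable borel" "finite (range g)"
    "\<And>y x. x \<in> cball x0 r \<Longrightarrow> q (g y - x) \<le> q (y - x) + \<eta>"
proof -
  have "bounded (q ` cball 0 r)"
    by (intro compact_imp_bounded compact_continuous_image continuous_on_subset[OF q]) auto
  then obtain B where B: "\<And>z. norm z \<le> r \<Longrightarrow> q z \<le> B" "0 < B"
    unfolding bounded_pos by (metis abs_le_D1 image_eqI mem_cball_0 real_norm_def)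
  \<comment> \<open>Outside radius \<open>R\<close> a point is at distance at least sqrt (B /
    \<epsilon>) from each admissible \<open>x\<close>, where coercivity forces a loss of at least
    \<open>B\<close>.\<close>
  define R where "R = r + sqrt (B / \<epsilon>)"
  have R: "r \<le> R" unfolding R_def using B \<open>\<epsilon> > 0\<close> by simp
  have far: "B \<le> q z" if "R - r \<le> norm z" for z
  proof -
    have "(sqrt (B / \<epsilon>))\<^sup>2 \<le> (norm z)\<^sup>2"
      using that B \<open>\<epsilon> > 0\<close> by (intro power_mono) (auto simp: R_def)
    then have "B / \<epsilon> \<le> (norm z)\<^sup>2" using B \<open>\<epsilon> > 0\<close> by simp
    then have "B \<le> \<epsilon> * (norm z)\<^sup>2" using \<open>\<epsilon> > 0\<close> by (simp add: field_simps)
    then show ?thesis using coer[of z] by linarith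
  qed
  \<comment> \<open>The extra 2 covers two steps of length at most 1: from a centre to
    \<open>y\<close>, and from \<open>y\<close> to its rounded value.\<close>
  have "uniformly_continuous_on (cball 0 (R + r + 2)) q"
    by (intro compact_uniformly_continuous continuous_on_subset[OF q]) auto
  then obtain d0 where d0: "d0 > 0" "\<And>z z'. norm z \<le> R + r + 2 \<Longrightarrow> norm z' \<le> R + r + 2 \<Longrightarrow>
      dist z' z < d0 \<Longrightarrow> dist (q z') (q z) < \<eta>"
    unfolding uniformly_continuous_on_def using \<open>\<eta> > 0\<close> by (metis mem_cball_0)
  define d where "d = min d0 1"
  have d: "0 < d" "d \<le> d0" "d \<le> 1" using d0 by (auto simp: d_def)
  have "cball x0 R \<subseteq> (\<Union>c\<in>cball x0 R. ball c d)" using d(1) centre_in_ball by blast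
  then obtain C where C: "C \<subseteq> cball x0 R" "finite C" "cball x0 R \<subseteq> (\<Union>c\<in>C. ball c d)"
    by (rule compactE_image[OF compact_cball open_ball])
  obtain g where g: "g \<in> borel_measurable borel" "finite (range g)"
    "\<And>y. y \<in> (\<Union>c\<in>C. ball c d) \<Longrightarrow> dist (g y) y < d" "\<And>y. y \<notin> (\<Union>c\<in>C. ball c d) \<Longrightarrow> g y = x0"
    using borel_measurable_cover_rounding[OF C(2), of d x0] by metis
  show thesis
  proof (rule that[OF g(1,2)])
    fix y x assume "x \<in> cball x0 r"
    then have x: "norm (x0 - x) \<le> r" by (simp add: dist_norm)
    show "q (g y - x) \<le> q (y - x) + \<eta>"
    proof (cases "y \<in> (\<Union>c\<in>C. ball c d)")
      case True
      then obtain c where c: "c \<in> C" "dist c y < d" by auto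
      then have "dist x0 c \<le> R" using C(1) by auto
      then have "dist x0 y \<le> R + 1" using c d dist_triangle[of x0 y c] by linarith
      moreover have gy: "dist (g y) y < d" using g(3)[OF True] .
      moreover have "dist (y - x) 0 \<le> dist x0 y + norm (x0 - x)"
        using norm_triangle_ineq[of "y - x0" "x0 - x"] by (simp add: dist_norm norm_minus_commute)
      moreover have "dist (g y - x) 0 \<le> dist (g y) y + norm (y - x)"
        using norm_triangle_ineq[of "g y - y" "y - x"] by (simp add: dist_norm)
      ultimately have "norm (y - x) \<le> R + r + 2" "norm (g y - x) \<le> R + r + 2"
        using x d by auto
      moreover have "dist (g y - x) (y - x) < d0" using gy d by (simp add: dist_norm)
      ultimately have "dist (q (g y - x)) (q (y - x)) < \<eta>" using d0(2) by blast
      then show ?thesis by (simp add: dist_real_def abs_less_iff)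
    next
      case False
      then have "y \<notin> cball x0 R" using C(3) by blast
      then have "R < norm (y - x0)" by (simp add: dist_norm norm_minus_commute)
      moreover have "norm (y - x0) \<le> norm (y - x) + norm (x0 - x)"
        using norm_triangle_ineq[of "y - x" "x - x0"] by (simp add: norm_minus_commute)
      ultimately have "R - r \<le> norm (y - x)" using x by linarith
      then show ?thesis using far[of "y - x"] B(1)[OF x] g(4)[OF False] \<open>\<eta> > 0\<close> by simp
    qed
  qed
qed

text \<open>The left side is the expectation of the loss of the rounded value, grouped by that
  value.\<close>

lemma (in finite_measure) sum_rounded_le_expectation:
  fixes f :: "'a \<Rightarrow> 'b::euclidean_space" and q :: "'b \<Rightarrow> real"
  assumes f: "f \<in> borel_measurable M" and M: "measure M (space M) = 1" and g: "g \<in> borel_measurable borel" "finite (range g)"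
    and int: "integrable M (\<lambda>x. q (f x - \<theta>))"
    and le: "\<And>y. q (g y - \<theta>) \<le> q (y - \<theta>) + \<eta>"
  shows "(\<Sum>y\<in>range g. q (y - \<theta>) * measure M {x \<in> space M. g (f x) = y})
    \<le> integral\<^sup>L M (\<lambda>x. q (f x - \<theta>)) + \<eta>"
proof -
  define A where "A y = {x \<in> space M. g (f x) = y}" for y
  have gf: "(\<lambda>x. g (f x)) \<in> borel_measurable M" using g(1) f by measurable
  have A: "A y \<in> sets M" for y
    unfolding A_def using measurable_sets[OF gf, of "{y}"] by (simp add: vimage_def Int_def conj_commute)
  have fin: "emeasure M (A y) < \<infinity>" for y by (simp add: less_top[symmetric])
  have iA: "integrable M (\<lambda>x. q (y - \<theta>) * indicator (A y) x)" for y
    using A fin by (intro integrable_mult_right integrable_real_indicator)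
  have eq: "(\<Sum>y\<in>range g. q (y - \<theta>) * indicator (A y) x) = q (g (f x) - \<theta>)" if "x \<in> space M" for x
  proof -
    have "(\<Sum>y\<in>range g. q (y - \<theta>) * indicator (A y) x)
        = (\<Sum>y\<in>range g. if y = g (f x) then q (y - \<theta>) else 0)"
      using that by (intro sum.cong refl) (auto simp: A_def indicator_def)
    also have "\<dots> = q (g (f x) - \<theta>)" using g(2) by (subst sum.delta) auto
    finally show ?thesis .
  qed
  have "(\<Sum>y\<in>range g. q (y - \<theta>) * measure M (A y))
      = (\<Sum>y\<in>range g. integral\<^sup>L M (\<lambda>x. q (y - \<theta>) * indicator (A y) x))"
    using A by (simp add: sets.Int_space_eq2)
  also have "\<dots> = integral\<^sup>L M (\<lambda>x. \<Sum>y\<in>range g. q (y - \<theta>) * indicator (A y) x)"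
    using iA by (subst Bochner_Integration.integral_sum) auto
  also have "\<dots> \<le> integral\<^sup>L M (\<lambda>x. q (f x - \<theta>) + \<eta>)"
  proof (rule integral_mono)
    show "integrable M (\<lambda>x. \<Sum>y\<in>range g. q (y - \<theta>) * indicator (A y) x)"
      using iA by (intro Bochner_Integration.integrable_sum)
    show "integrable M (\<lambda>x. q (f x - \<theta>) + \<eta>)" using int by simp
  qed (simp add: eq le)
  also have "\<dots> = integral\<^sup>L M (\<lambda>x. q (f x - \<theta>)) + \<eta>" using int by (simp add: M)
  finally show ?thesis unfolding A_def .
qed

section \<open>Vector fields with negative divergence\<close>

lemma cball_subset_cbox_One:
  fixes x :: "'a::euclidean_space"
  shows "cball x r \<subseteq> cbox (x - r *\<^sub>R One) (x + r *\<^sub>R One)"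
proof
  fix y assume "y \<in> cball x r"
  then have "norm (y - x) \<le> r" by (simp add: dist_norm norm_minus_commute)
  then have "\<bar>(y - x) \<bullet> i\<bar> \<le> r" if "i \<in> Basis" for i
    using Basis_le_norm[OF that, of "y - x"] by linarith
  then show "y \<in> cbox (x - r *\<^sub>R One) (x + r *\<^sub>R One)"
    by (fastforce simp: mem_box inner_diff_left inner_add_left abs_le_iff)
qed

text \<open>By translation invariance the integral of f (x + t e) does not depend on
  \<open>t\<close>; differentiating under the integral at t = 0 gives the claim.\<close>

lemma has_integral_derivative_compact_support:
  fixes f :: "'a::euclidean_space \<Rightarrow> real"
  assumes f: "\<And>x. (f has_derivative f' x) (at x)"
    and cont: "continuous_on UNIV (\<lambda>x. f' x e)"
    and supp: "\<And>x. x \<notin> cball x0 r \<Longrightarrow> f x = 0"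
  shows "((\<lambda>x. f' x e) has_integral 0) UNIV"
proof -
  \<comment> \<open>For |t| < 1 the translates of the support still lie in the box of half-width
    \<open>R\<close>.\<close>
  define R where "R = \<bar>r\<bar> + norm e"
  let ?box = "\<lambda>R. cbox (x0 - R *\<^sub>R One) (x0 + R *\<^sub>R One)"
  have supp': "f x = 0" if "x \<notin> ?box \<bar>r\<bar>" for x
    using supp[of x] cball_subset_cbox_One[of x0 "\<bar>r\<bar>"] that by force
  have fc: "continuous_on A f" for A
    by (intro continuous_at_imp_continuous_on ballI has_derivative_continuous[OF f])
  have f'0: "f' x e = 0" if "x \<notin> ?box R" for x
  proof -
    have x: "x \<in> - cball x0 r" 
    proof -
      have "cball x0 r \<subseteq> cball x0 R" unfolding R_def by (rule subset_cball) (simp add: add_increasing2)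
      then show ?thesis using that cball_subset_cbox_One[of x0 R] by blast
    qed
    have "((\<lambda>x. 0) has_derivative f' x) (at x)"
      by (rule has_derivative_transform_within_open[OF f _ x]) (use supp in \<open>auto simp: open_Compl\<close>)
    then have "f' x = (\<lambda>h. 0)" by (rule has_derivative_unique[OF _ has_derivative_const])
    then show ?thesis by simp
  qed
  have I: "(f has_integral integral (?box \<bar>r\<bar>) f) (?box \<bar>r\<bar>)"
    by (intro integrable_integral integrable_continuous fc)
  have const: "integral (?box R) (\<lambda>x. f (x + t *\<^sub>R e)) = integral (?box \<bar>r\<bar>) f" if "t \<in> ball 0 1" for t
  proof -
    have sub: "?box \<bar>r\<bar> \<subseteq> cbox (x0 - R *\<^sub>R One + t *\<^sub>R e) (x0 + R *\<^sub>R One + t *\<^sub>R e)"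
    proof (rule subset_box_imp, intro ballI)
      fix i :: 'a assume i: "i \<in> Basis"
      have "\<bar>t\<bar> * \<bar>e \<bullet> i\<bar> \<le> 1 * norm e"
        using that Basis_le_norm[OF i, of e] by (intro mult_mono) auto
      then have "\<bar>t * (e \<bullet> i)\<bar> \<le> norm e" by (simp add: abs_mult)
      then show "(x0 - R *\<^sub>R One + t *\<^sub>R e) \<bullet> i \<le> (x0 - \<bar>r\<bar> *\<^sub>R One) \<bullet> i \<and>
          (x0 + \<bar>r\<bar> *\<^sub>R One) \<bullet> i \<le> (x0 + R *\<^sub>R One + t *\<^sub>R e) \<bullet> i"
        using i by (simp add: R_def inner_add_left inner_diff_left abs_le_iff)
    qed
    have "integral (?box R) (\<lambda>x. f (x + t *\<^sub>R e))
        = integral (cbox (x0 - R *\<^sub>R One + t *\<^sub>R e) (x0 + R *\<^sub>R One + t *\<^sub>R e)) f"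
      using integral_shift_cbox_plus[of _ _ f "t *\<^sub>R e"] by (simp add: o_def add.commute)
    also have "\<dots> = integral (?box \<bar>r\<bar>) f"
      using has_integral_on_superset[OF I supp' sub] by (rule integral_unique)
    finally show ?thesis .
  qed
  have "((\<lambda>t. integral (?box R) (\<lambda>x. f (x + t *\<^sub>R e))) has_vector_derivative
      integral (?box R) (\<lambda>x. f' (x + 0 *\<^sub>R e) e)) (at 0 within UNIV)"
  proof (rule leibniz_rule_vector_derivative[where fx = "\<lambda>t x. f' (x + t *\<^sub>R e) e"])
    fix t :: real and x
    have "((\<lambda>t. x + t *\<^sub>R e) has_derivative (\<lambda>t. t *\<^sub>R e)) (at t)"
      by (auto intro!: derivative_eq_intros)
    from diff_chain_at[OF this f]
    have "((\<lambda>t. f (x + t *\<^sub>R e)) has_derivative (\<lambda>s. f' (x + t *\<^sub>R e) (s *\<^sub>R e))) (at t)"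
      by (simp add: o_def)
    then show "((\<lambda>t. f (x + t *\<^sub>R e)) has_vector_derivative f' (x + t *\<^sub>R e) e) (at t within UNIV)"
      unfolding has_vector_derivative_def
      using linear_scale[OF has_derivative_linear[OF f]] by simp
    show "(\<lambda>x. f (x + t *\<^sub>R e)) integrable_on ?box R"
      by (intro integrable_continuous continuous_on_compose2[OF fc[of UNIV]] continuous_intros) auto
    show "continuous_on (UNIV \<times> ?box R) (\<lambda>(t, x). f' (x + t *\<^sub>R e) e)"
      unfolding split_beta by (intro continuous_on_compose2[OF cont] continuous_intros) auto
  qed auto
  moreover have "((\<lambda>t. integral (?box R) (\<lambda>x. f (x + t *\<^sub>R e))) has_vector_derivative 0) (at 0)"
    by (rule has_vector_derivative_transform_within_open[of "\<lambda>_. integral (?box \<bar>r\<bar>) f" _ _ "ball 0 1"])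
       (use const in auto)
  ultimately have "integral (?box R) (\<lambda>x. f' (x + 0 *\<^sub>R e) e) = 0"
    by (rule vector_derivative_unique_at)
  then have "integral (?box R) (\<lambda>x. f' x e) = 0" by simp
  moreover have "(\<lambda>x. f' x e) integrable_on ?box R"
    by (intro integrable_continuous continuous_on_subset[OF cont]) auto
  ultimately have "((\<lambda>x. f' x e) has_integral 0) (?box R)"
    by (metis integrable_integral)
  then show ?thesis by (rule has_integral_on_superset) (use f'0 in auto)
qed

text \<open>Squaring smooths the kink at 0, which makes the truncated paraboloid squared a C^1 bump
  function.\<close>

lemma DERIV_max_0_squared: "((\<lambda>s::real. (max 0 s)\<^sup>2) has_real_derivative 2 * max 0 s) (at s)"
proof -
  consider "s < 0" | "s = 0" | "0 < s" by linarith
  then show ?thesis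
  proof cases
    case 1
    have "((\<lambda>s::real. (max 0 s)\<^sup>2) has_real_derivative 0) (at s)"
      by (rule has_field_derivative_transform_within_open[of "\<lambda>_. 0" _ _ "{..<0}"])
         (use 1 in auto)
    then show ?thesis using 1 by simp
  next
    case 2
    have "(\<lambda>h::real. ((max 0 (0 + h))\<^sup>2 - (max 0 0)\<^sup>2) / h) = (\<lambda>h. max 0 h)"
      by (auto simp: fun_eq_iff max_def power2_eq_square)
    moreover have "((\<lambda>h::real. max 0 h) \<longlongrightarrow> max 0 0) (at 0)"
      by (intro tendsto_intros)
    ultimately show ?thesis unfolding 2 DERIV_def by simp
  next
    case 3
    have "((\<lambda>s::real. s\<^sup>2) has_real_derivative 2 * s) (at s)"
      by (auto intro!: derivative_eq_intros)
    then have "((\<lambda>s::real. (max 0 s)\<^sup>2) has_real_derivative 2 * s) (at s)"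
      by (rule has_field_derivative_transform_within_open[of _ _ _ "{0<..}"]) (use 3 in auto)
    then show ?thesis using 3 by simp
  qed
qed

text \<open>The integral of div(\<open>\<phi>\<close> W) is 0, hence c times the integral of
  \<open>\<phi>\<close> is at most \<delta> times the integral of |grad \<open>\<phi>\<close>|. The
  constant \<open>K\<close> is the ratio of these integrals; it depends only on the ball, so it is
  uniform over a sequence of fields.\<close>

lemma divergence_bound:
  fixes x0 :: "real^'p"
  assumes r: "r > 0"
  obtains K where "\<And>S W W' c \<delta>. open S \<Longrightarrow> cball x0 r \<subseteq> S \<Longrightarrow>
     (\<And>x. x \<in> S \<Longrightarrow> (W has_derivative W' x) (at x)) \<Longrightarrow>
     (\<And>k. continuous_on S (\<lambda>x. W' x (axis k 1) $ k)) \<Longrightarrow>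
     (\<And>x. x \<in> cball x0 r \<Longrightarrow> norm (W x :: real^'p) \<le> \<delta>) \<Longrightarrow>
     (\<And>x. x \<in> cball x0 r \<Longrightarrow> (\<Sum>k\<in>UNIV. W' x (axis k 1) $ k) \<le> - c) \<Longrightarrow> c \<le> K * \<delta>"
proof -
  define m where "m x = max 0 (r\<^sup>2 - (x - x0) \<bullet> (x - x0))" for x
  define \<phi> where "\<phi> x = (m x)\<^sup>2" for x
  define \<phi>' where "\<phi>' x h = - 4 * m x * ((x - x0) \<bullet> h)" for x h
  \<comment> \<open>The norm of the gradient of \<open>\<phi>\<close>.\<close>
  define \<psi> where "\<psi> x = 4 * m x * norm (x - x0)" for x
  let ?B = "cbox (x0 - r *\<^sub>R One) (x0 + r *\<^sub>R One)"
  have m0: "m x = 0" if "x \<notin> cball x0 r" for x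
  proof -
    have "r < norm (x - x0)" using that by (simp add: dist_norm norm_minus_commute)
    then have "r\<^sup>2 < (norm (x - x0))\<^sup>2" using r by (intro power_strict_mono) auto
    then show ?thesis by (simp add: m_def power2_norm_eq_inner)
  qed
  have m_nonneg: "0 \<le> m x" for x by (simp add: m_def)
  have cm: "continuous_on A m" for A unfolding m_def by (intro continuous_intros)
  have c\<phi>: "continuous_on A \<phi>" for A unfolding \<phi>_def by (intro continuous_intros cm)
  have c\<phi>': "continuous_on A (\<lambda>x. \<phi>' x h)" for A h unfolding \<phi>'_def by (intro continuous_intros cm)
  have c\<psi>: "continuous_on A \<psi>" for A unfolding \<psi>_def by (intro continuous_intros cm)
  have d\<phi>: "(\<phi> has_derivative \<phi>' x) (at x)" for x
  proof -
    have "((\<lambda>x. r\<^sup>2 - (x - x0) \<bullet> (x - x0)) has_derivative (\<lambda>h. - 2 * ((x - x0) \<bullet> h))) (at x)"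
      by (auto intro!: derivative_eq_intros simp: inner_commute)
    from diff_chain_at[OF this DERIV_max_0_squared[unfolded has_field_derivative_def]]
    show ?thesis by (simp add: o_def \<phi>_def[abs_def] m_def \<phi>'_def[abs_def] mult_ac)
  qed
  have ext: "(g has_integral integral ?B g) UNIV"
    if "continuous_on ?B g" "\<And>x. x \<notin> cball x0 r \<Longrightarrow> g x = 0" for g :: "real^'p \<Rightarrow> real"
  proof (rule has_integral_on_superset[OF integrable_integral[OF integrable_continuous]])
    show "g x = 0" if "x \<notin> ?B" for x
      using that \<open>\<And>x. x \<notin> cball x0 r \<Longrightarrow> g x = 0\<close> cball_subset_cbox_One[of x0 r] by blast
  qed (use that in auto)
  define I1 where "I1 = integral ?B \<phi>"
  define I2 where "I2 = integral ?B \<psi>"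
  have I1: "(\<phi> has_integral I1) UNIV" unfolding I1_def by (rule ext[OF c\<phi>]) (simp add: \<phi>_def m0)
  have I2: "(\<psi> has_integral I2) UNIV" unfolding I2_def by (rule ext[OF c\<psi>]) (simp add: \<psi>_def m0)
  have "0 \<le> I1" unfolding I1_def
    by (intro integral_nonneg integrable_continuous c\<phi>) (simp add: \<phi>_def)
  moreover have "I1 \<noteq> 0"
  proof
    assume "I1 = 0"
    then have "(\<phi> has_integral 0) ?B"
      unfolding I1_def using integrable_integral[OF integrable_continuous[OF c\<phi>]] by metis
    moreover have "box (x0 - r *\<^sub>R One) (x0 + r *\<^sub>R One) \<noteq> {}"
      using r by (simp add: box_ne_empty inner_diff_left inner_add_left)
    moreover have "x0 \<in> ?B" using cball_subset_cbox_One[of x0 r] r by force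
    ultimately have "\<phi> x0 = 0"
      using has_integral_0_cbox_imp_0[OF c\<phi>] by (metis \<phi>_def zero_le_power2)
    then show False using r by (simp add: \<phi>_def m_def)
  qed
  ultimately have I1pos: "0 < I1" by simp
  show thesis
  proof (rule that[of "I2 / I1"])
    fix S and W :: "real^'p \<Rightarrow> real^'p" and W' c \<delta>
    assume S: "open S" "cball x0 r \<subseteq> S"
      and W: "\<And>x. x \<in> S \<Longrightarrow> (W has_derivative W' x) (at x)"
      and cW: "\<And>k. continuous_on S (\<lambda>x. W' x (axis k 1) $ k)"
      and \<delta>: "\<And>x. x \<in> cball x0 r \<Longrightarrow> norm (W x) \<le> \<delta>"
      and div: "\<And>x. x \<in> cball x0 r \<Longrightarrow> (\<Sum>k\<in>UNIV. W' x (axis k 1) $ k) \<le> - c"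
    \<comment> \<open>Extended by 0 so as to be differentiable everywhere: \<open>S\<close> and the
      complement of the ball form an open cover, and the field is only controlled on
      \<open>S\<close>.\<close>
    define f where "f k x = (if x \<in> S then \<phi> x * W x $ k else 0)" for k x
    define f' where "f' k x h = (if x \<in> S then \<phi> x * W' x h $ k + \<phi>' x h * W x $ k else 0)" for k x h
    have cover: "S \<union> - cball x0 r = UNIV" using S by auto
    have f'0: "f' k x h = 0" if "x \<notin> cball x0 r" for k x h
      using m0[OF that] by (simp add: f'_def \<phi>_def \<phi>'_def)
    have f0: "f k x = 0" if "x \<notin> cball x0 r" for k x
      using m0[OF that] by (simp add: f_def \<phi>_def)
    have df: "(f k has_derivative f' k x) (at x)" for k x
    proof (cases "x \<in> S")
      case True
      have "((\<lambda>x. \<phi> x * W x $ k) has_derivative (\<lambda>h. \<phi> x * W' x h $ k + \<phi>' x h * W x $ k)) (at x)"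
        by (intro has_derivative_mult d\<phi> bounded_linear.has_derivative[OF bounded_linear_vec_nth] W True)
      moreover have "f' k x = (\<lambda>h. \<phi> x * W' x h $ k + \<phi>' x h * W x $ k)"
        using True by (simp add: f'_def fun_eq_iff)
      ultimately show ?thesis
        using has_derivative_transform_within_open[OF _ S(1) True, of "\<lambda>x. \<phi> x * W x $ k" _ UNIV "f k"]
        by (simp add: f_def)
    next
      case False
      then have x: "x \<in> - cball x0 r" using S by auto
      have "f' k x = (\<lambda>h. 0)" using False by (simp add: f'_def fun_eq_iff)
      then show ?thesis
        using has_derivative_transform_within_open[OF has_derivative_const[of 0] open_Compl[OF closed_cball] x, of "f k"] f0
        by auto
    qed
    have Wc: "continuous_on S W" 
      by (intro continuous_at_imp_continuous_on ballI has_derivative_continuous[OF W])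
    have cf: "continuous_on UNIV (\<lambda>x. f' k x (axis k 1))" for k
    proof -
      have "continuous_on S (\<lambda>x. f' k x (axis k 1))"
      proof (rule continuous_on_eq)
        show "continuous_on S (\<lambda>x. \<phi> x * W' x (axis k 1) $ k + \<phi>' x (axis k 1) * W x $ k)"
          by (intro continuous_intros c\<phi> c\<phi>' cW Wc)
      qed (simp add: f'_def)
      moreover have "continuous_on (- cball x0 r) (\<lambda>x. f' k x (axis k 1))"
        by (rule continuous_on_eq[OF continuous_on_const[of _ 0]]) (use f'0 in auto)
      ultimately show ?thesis
        unfolding cover[symmetric] by (intro continuous_on_open_Un S open_Compl closed_cball)
    qed
    have "((\<lambda>x. \<Sum>k\<in>UNIV. f' k x (axis k 1)) has_integral (\<Sum>k\<in>(UNIV::'p set). 0)) UNIV"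
      by (intro has_integral_sum has_integral_derivative_compact_support[OF df cf f0]) auto
    then have z: "((\<lambda>x. \<Sum>k\<in>UNIV. f' k x (axis k 1)) has_integral 0) UNIV" by simp
    have "((\<lambda>x. - c * \<phi> x + \<delta> * \<psi> x) has_integral (- c * I1 + \<delta> * I2)) UNIV"
      by (intro has_integral_add has_integral_mult_right I1 I2)
    moreover have "(\<Sum>k\<in>UNIV. f' k x (axis k 1)) \<le> - c * \<phi> x + \<delta> * \<psi> x" for x
    proof (cases "x \<in> cball x0 r")
      case True
      have sum: "(\<Sum>k\<in>UNIV. ((x - x0) \<bullet> axis k 1) * W x $ k) = (x - x0) \<bullet> W x"
        by (simp only: inner_axis inner_vec_def[of "x - x0" "W x"]) simp
      have "(\<Sum>k\<in>UNIV. f' k x (axis k 1))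
          = \<phi> x * (\<Sum>k\<in>UNIV. W' x (axis k 1) $ k) + - 4 * m x * ((x - x0) \<bullet> W x)"
      proof -
        have "x \<in> S" using True S by blast
        then have "f' k x (axis k 1)
            = \<phi> x * W' x (axis k 1) $ k + - 4 * m x * (((x - x0) \<bullet> axis k 1) * W x $ k)" for k
          by (simp add: f'_def \<phi>'_def)
        then show ?thesis unfolding sum[symmetric] by (simp only: sum.distrib sum_distrib_left)
      qed
      also have "\<dots> \<le> \<phi> x * (- c) + 4 * m x * (norm (x - x0) * \<delta>)"
      proof (intro add_mono mult_left_mono div[OF True])
        have "\<bar>(x - x0) \<bullet> W x\<bar> \<le> norm (x - x0) * norm (W x)" by (rule Cauchy_Schwarz_ineq2)
        also have "\<dots> \<le> norm (x - x0) * \<delta>" using \<delta>[OF True] by (intro mult_left_mono) auto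
        finally have "- ((x - x0) \<bullet> W x) \<le> norm (x - x0) * \<delta>" by linarith
        then have "4 * m x * (- ((x - x0) \<bullet> W x)) \<le> 4 * m x * (norm (x - x0) * \<delta>)"
          by (rule mult_left_mono) (simp add: m_nonneg)
        then show "- 4 * m x * ((x - x0) \<bullet> W x) \<le> 4 * m x * (norm (x - x0) * \<delta>)"
          by (simp only: mult_minus_left mult_minus_right)
      qed (simp add: \<phi>_def)
      finally show ?thesis by (simp add: \<psi>_def mult_ac)
    next
      case False
      then show ?thesis using m0[OF False] by (simp add: f'0 \<phi>_def \<psi>_def)
    qed
    ultimately have "0 \<le> - c * I1 + \<delta> * I2" using has_integral_le[OF z] by blast
    then show "c \<le> I2 / I1 * \<delta>" using I1pos by (simp add: field_simps)
  qed
qed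

section \<open>The asymptotic bound\<close>

text \<open>Coercivity of \<open>q\<close> bounds the mean squared error, hence the bias, by the
  loss. The divergence is a sum over the values \<open>y\<close> of the derivative of the
  probability of \<open>y\<close> along \<open>T (y - \<theta>)\<close>, minus
  \<open>trace D\<close>, and each summand is covered by the information inequality.\<close>

lemma bias_vector_field:
  fixes \<rho> :: "real^'p \<Rightarrow> complex^2^2" and D :: "real^'p^'p" and est :: "'x \<Rightarrow> real^'p"
  assumes \<Theta>: "open \<Theta>" and \<rho>': "\<And>\<theta>. \<theta> \<in> \<Theta> \<Longrightarrow> (\<rho> has_derivative \<rho>' \<theta>) (at \<theta>)"
    and \<rho>'_cont: "\<And>h. continuous_on \<Theta> (\<lambda>\<theta>. \<rho>' \<theta> h)"
    and model: "pure_state_model \<Theta> \<rho> \<or> mixed_state_model \<Theta> \<rho>"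
    and n: "n \<ge> 1" and M: "measurement (copies_basis n) X M"
    and refinable: "mixed_state_model \<Theta> \<rho> \<Longrightarrow> \<exists>(Y :: 'y measure) N.
            refinement (copies_basis n) Y N X M \<and> product_form n Y N"
    and est: "est \<in> borel_measurable X"
    and q: "continuous_on UNIV q" and \<epsilon>: "\<epsilon> > 0" and coer: "\<And>z. \<epsilon> * (norm z)\<^sup>2 \<le> q z"
    and ball: "cball x0 r \<subseteq> \<Theta>" "r \<ge> 0"
    and dom: "\<And>\<theta> z. \<theta> \<in> cball x0 r \<Longrightarrow>
      (transpose D *v z) \<bullet> (quantum_information \<rho> \<theta> *v (transpose D *v z)) \<le> q z"
    and int: "\<And>\<theta>. \<theta> \<in> cball x0 r \<Longrightarrow>
      integrable (copies_distribution n (\<rho> \<theta>) X M) (\<lambda>x. q (est x - \<theta>))"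
    and b: "\<And>\<theta>. \<theta> \<in> cball x0 r \<Longrightarrow>
      real n * integral\<^sup>L (copies_distribution n (\<rho> \<theta>) X M) (\<lambda>x. q (est x - \<theta>)) \<le> b"
    and \<delta>: "\<delta> > 0" and L: "L \<ge> 0" "\<And>z. norm (transpose D *v z) \<le> L * norm z"
  obtains W W' where
    "\<And>\<theta>. \<theta> \<in> \<Theta> \<Longrightarrow> (W has_derivative W' \<theta>) (at \<theta>)"
    "\<And>k. continuous_on \<Theta> (\<lambda>\<theta>. W' \<theta> (axis k 1) $ k)"
    "\<And>\<theta>. \<theta> \<in> cball x0 r \<Longrightarrow> norm (W \<theta> :: real^'p) \<le> L * sqrt ((b + \<delta>) / (\<epsilon> * real n))"
    "\<And>\<theta>. \<theta> \<in> cball x0 r \<Longrightarrow> (\<Sum>k\<in>UNIV. W' \<theta> (axis k 1) $ k) \<le> (b + \<delta> + 1) / 2 - trace D"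
proof -
  let ?I = "copies_basis n"
  have n0: "0 < real n" using n by simp
  \<comment> \<open>The tolerance is divided by \<open>n\<close> because the loss is multiplied by
    \<open>n\<close> later.\<close>
  obtain g where g: "g \<in> borel_measurable borel" "finite (range g)"
    and g_le: "\<And>y x. x \<in> cball x0 r \<Longrightarrow> q (g y - x) \<le> q (y - x) + \<delta> / real n"
    by (rule coercive_rounding[OF q \<epsilon> coer divide_pos_pos[OF \<delta> n0] \<open>r \<ge> 0\<close>]) blast
  define J where "J = range g"
  define A where "A y = {x \<in> space X. g (est x) = y}" for y
  have gest: "(\<lambda>x. g (est x)) \<in> borel_measurable X" using g(1) est by measurable
  have A: "A y \<in> sets X" for y
    unfolding A_def using measurable_sets[OF gest, of "{y}"] by (simp add: vimage_def Int_def conj_commute)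
  have J: "finite J" using g by (simp add: J_def)
  have part: "disjoint_family_on A J" "(\<Union>y\<in>J. A y) = space X"
    by (auto simp: A_def J_def disjoint_family_on_def)
  note partition = mtrace_measurement_partition[OF M J A part finite_copies_basis]
  define m where "m y \<theta> = Re (mtrace ?I (tensor_power n (\<rho> \<theta>)) (M (A y)))" for y \<theta>
  define m' where "m' y \<theta> h = Re (mtrace ?I (dtensor n (\<rho> \<theta>) (\<rho>' \<theta> h)) (M (A y)))" for y \<theta> h
  have bloch: "\<exists>a. \<rho> \<theta> = bloch_state a \<and> norm a \<le> 1" if "\<theta> \<in> \<Theta>" for \<theta>
    using model that unfolding pure_state_model_def mixed_state_model_def
    by (metis less_eq_real_def order_refl)
  have dm: "((\<lambda>\<theta>. m y \<theta>) has_derivative m' y \<theta>) (at \<theta>)" if "\<theta> \<in> \<Theta>" for y \<theta>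
    unfolding m_def m'_def
    by (intro bounded_linear.has_derivative[OF bounded_linear_Re] has_derivative_mtrace_tensor_power \<rho>' that)
  have \<rho>_cont: "continuous_on \<Theta> \<rho>"
    by (intro continuous_at_imp_continuous_on ballI has_derivative_continuous[OF \<rho>'])
  have m'_cont: "continuous_on \<Theta> (\<lambda>\<theta>. m' y \<theta> h)" for y h
    unfolding m'_def by (intro continuous_intros continuous_on_mtrace_dtensor \<rho>_cont \<rho>'_cont)
  have sum_m: "(\<Sum>y\<in>J. m y \<theta>) = 1" if \<theta>: "\<theta> \<in> \<Theta>" for \<theta>
  proof -
    obtain a where "\<rho> \<theta> = bloch_state a" using bloch[OF \<theta>] by blast
    then have "trace (\<rho> \<theta>) = 1" by (simp add: bloch_state_pauli trace_pauli)
    then have "(\<Sum>s\<in>?I. tensor_power n (\<rho> \<theta>) s s) = 1" unfolding tensor_power_def trace_tensor by simp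
    then show ?thesis unfolding m_def Re_sum[symmetric] partition by simp
  qed
  have sum_m': "(\<Sum>y\<in>J. m' y \<theta> h) = 0" if \<theta>: "\<theta> \<in> \<Theta>" for \<theta> h
  proof -
    have "((\<lambda>\<theta>. \<Sum>y\<in>J. m y \<theta>) has_derivative (\<lambda>h. \<Sum>y\<in>J. m' y \<theta> h)) (at \<theta>)"
      by (intro has_derivative_sum dm \<theta>)
    moreover have "((\<lambda>\<theta>. \<Sum>y\<in>J. m y \<theta>) has_derivative (\<lambda>h. 0)) (at \<theta>)"
      by (rule has_derivative_transform_within_open[OF has_derivative_const[of 1] \<Theta> \<theta>])
         (simp add: sum_m)
    ultimately have "(\<lambda>h. \<Sum>y\<in>J. m' y \<theta> h) = (\<lambda>h. 0)" by (rule has_derivative_unique)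
    then show ?thesis by (rule fun_cong)
  qed
  have m'_lin: "linear (m' y \<theta>)" if "\<theta> \<in> \<Theta>" for y \<theta>
    using dm[OF that] by (rule has_derivative_linear)
  define T where "T z = transpose D *v z" for z
  have T: "bounded_linear T" unfolding T_def by (rule matrix_vector_mul_bounded_linear)
  have T_lin: "linear T" using T by (rule bounded_linear.linear)
  \<comment> \<open>\<open>D\<^sup>T\<close> applied to the bias of the rounded estimator\<close>
  define W where "W \<theta> = T ((\<Sum>y\<in>J. m y \<theta> *\<^sub>R y) - \<theta>)" for \<theta>
  define W' where "W' \<theta> h = T ((\<Sum>y\<in>J. m' y \<theta> h *\<^sub>R y) - h)" for \<theta> h
  have W'_k: "W' \<theta> h $ k = (\<Sum>y\<in>J. m' y \<theta> h * T y $ k) - T h $ k" for \<theta> h k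
    unfolding W'_def by (simp add: linear_diff[OF T_lin] linear_sum[OF T_lin] linear_scale[OF T_lin])
  \<comment> \<open>The derivatives of the probabilities sum to 0, so \<open>y\<close> may be
    recentred to the error \<open>y - \<theta>\<close>, the quantity that the loss controls.\<close>
  have div_eq: "(\<Sum>k\<in>UNIV. W' \<theta> (axis k 1) $ k) = (\<Sum>y\<in>J. m' y \<theta> (T (y - \<theta>))) - trace D"
    if \<theta>: "\<theta> \<in> \<Theta>" for \<theta>
  proof -
    have expand: "m' y \<theta> z = (\<Sum>k\<in>UNIV. m' y \<theta> (axis k 1) * z $ k)" for y z
    proof -
      have "m' y \<theta> z = m' y \<theta> (\<Sum>k\<in>UNIV. (z $ k) *\<^sub>R axis k 1)"
        using basis_expansion[of z] by (simp add: scalar_mult_eq_scaleR)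
      also have "\<dots> = (\<Sum>k\<in>UNIV. m' y \<theta> (axis k 1) * z $ k)"
        by (simp add: linear_sum[OF m'_lin[OF \<theta>]] linear_scale[OF m'_lin[OF \<theta>]] mult.commute)
      finally show ?thesis .
    qed
    have "(\<Sum>y\<in>J. m' y \<theta> (T (y - \<theta>))) = (\<Sum>y\<in>J. m' y \<theta> (T y)) - (\<Sum>y\<in>J. m' y \<theta> (T \<theta>))"
      by (simp add: linear_diff[OF T_lin] linear_diff[OF m'_lin[OF \<theta>]] sum_subtractf)
    also have "\<dots> = (\<Sum>y\<in>J. \<Sum>k\<in>UNIV. m' y \<theta> (axis k 1) * T y $ k)"
      unfolding sum_m'[OF \<theta>] diff_zero by (intro sum.cong refl expand)
    also have "\<dots> = (\<Sum>k\<in>UNIV. \<Sum>y\<in>J. m' y \<theta> (axis k 1) * T y $ k)" by (rule sum.swap)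
    finally have "(\<Sum>k\<in>UNIV. W' \<theta> (axis k 1) $ k) = (\<Sum>y\<in>J. m' y \<theta> (T (y - \<theta>))) - (\<Sum>k\<in>UNIV. T (axis k 1) $ k)"
      by (simp add: W'_k sum_subtractf)
    also have "(\<Sum>k\<in>UNIV. T (axis k 1) $ k) = trace D"
      by (simp add: T_def trace_def matrix_vector_mult_basis column_def transpose_def)
    finally show ?thesis .
  qed
  have qm: "real n * (\<Sum>y\<in>J. q (y - \<theta>) * m y \<theta>) \<le> b + \<delta>" and m0: "\<And>y. 0 \<le> m y \<theta>"
    if \<theta>: "\<theta> \<in> cball x0 r" for \<theta>
  proof -
    obtain a where a: "\<rho> \<theta> = bloch_state a" "norm a \<le> 1" using bloch \<theta> ball by blast
    note P = copies_distribution[OF a(2) M, folded a(1)]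
    let ?P = "copies_distribution n (\<rho> \<theta>) X M"
    have mP: "m y \<theta> = measure ?P {x \<in> space ?P. g (est x) = y}" for y
      using P(5)[OF A[of y]] unfolding m_def P(2) A_def by simp
    then show "0 \<le> m y \<theta>" for y by simp
    have "est \<in> borel_measurable ?P" using est measurable_cong_sets[OF P(1) refl] by blast
    from finite_measure.sum_rounded_le_expectation[OF P(3) this P(4) g int[OF \<theta>] g_le[OF \<theta>]]
    have "(\<Sum>y\<in>J. q (y - \<theta>) * m y \<theta>) \<le> integral\<^sup>L ?P (\<lambda>x. q (est x - \<theta>)) + \<delta> / real n"
      unfolding mP J_def .
    then have "real n * (\<Sum>y\<in>J. q (y - \<theta>) * m y \<theta>)
        \<le> real n * (integral\<^sup>L ?P (\<lambda>x. q (est x - \<theta>)) + \<delta> / real n)"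
      by (rule mult_left_mono) simp
    also have "\<dots> \<le> b + \<delta>" using b[OF \<theta>] n0 by (simp add: distrib_left)
    finally show "real n * (\<Sum>y\<in>J. q (y - \<theta>) * m y \<theta>) \<le> b + \<delta>" .
  qed
  show thesis
  proof (rule that[of W W'])
    fix \<theta> assume \<theta>: "\<theta> \<in> \<Theta>"
    show "(W has_derivative W' \<theta>) (at \<theta>)"
      unfolding W_def W'_def
      by (intro bounded_linear.has_derivative[OF T] has_derivative_diff has_derivative_sum
          has_derivative_scaleR_left dm \<theta> has_derivative_ident)
  next
    show "continuous_on \<Theta> (\<lambda>\<theta>. W' \<theta> (axis k 1) $ k)" for k
      unfolding W'_k by (intro continuous_intros m'_cont)
  next
    fix \<theta> assume \<theta>: "\<theta> \<in> cball x0 r"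
    then have \<theta>': "\<theta> \<in> \<Theta>" using ball by blast
    define s where "s = (b + \<delta>) / (\<epsilon> * real n)"
    have "\<epsilon> * (\<Sum>y\<in>J. (norm (y - \<theta>))\<^sup>2 * m y \<theta>) \<le> (\<Sum>y\<in>J. q (y - \<theta>) * m y \<theta>)"
      unfolding sum_distrib_left mult.assoc[symmetric]
      by (intro sum_mono mult_right_mono coer m0 \<theta>)
    also have "\<dots> \<le> (b + \<delta>) / real n" using qm[OF \<theta>] n0 by (simp add: field_simps)
    also have "\<dots> = \<epsilon> * s" unfolding s_def using \<epsilon> by simp
    finally have s: "(\<Sum>y\<in>J. (norm (y - \<theta>))\<^sup>2 * m y \<theta>) \<le> s"
      by (rule mult_left_le_imp_le) (rule \<epsilon>)
    have s0: "0 \<le> s"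
      using s by (rule order_trans[rotated]) (intro sum_nonneg mult_nonneg_nonneg m0 \<theta>; simp)
    have "(\<Sum>y\<in>J. m y \<theta> *\<^sub>R y) - \<theta> = (\<Sum>y\<in>J. m y \<theta> *\<^sub>R (y - \<theta>))"
      using sum_m[OF \<theta>'] by (simp add: scaleR_diff_right sum_subtractf flip: scaleR_sum_left)
    then have "norm ((\<Sum>y\<in>J. m y \<theta> *\<^sub>R y) - \<theta>) \<le> (\<Sum>y\<in>J. m y \<theta> * norm (y - \<theta>))"
      using norm_sum[of "\<lambda>y. m y \<theta> *\<^sub>R (y - \<theta>)" J] m0[OF \<theta>] by simp
    also have "\<dots> \<le> sqrt s"
    proof (cases "s = 0")
      case True
      have "(\<Sum>y\<in>J. (norm (y - \<theta>))\<^sup>2 * m y \<theta>) = 0"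
        using s True by (intro order_antisym sum_nonneg) (auto simp: m0[OF \<theta>])
      then have "\<forall>y\<in>J. (norm (y - \<theta>))\<^sup>2 * m y \<theta> = 0"
        using J by (subst (asm) sum_nonneg_eq_0_iff) (auto simp: m0[OF \<theta>])
      then have "(\<Sum>y\<in>J. m y \<theta> * norm (y - \<theta>)) = 0" by (intro sum.neutral) auto
      then show ?thesis using True by simp
    next
      case False
      then have sq: "0 < sqrt s" using s0 by simp
      \<comment> \<open>Cauchy-Schwarz through 2 u v \<le> u^2 + v^2, to be divided by
        \<open>2 * sqrt s\<close>; this is why s = 0 was treated apart.\<close>
      have "2 * sqrt s * (\<Sum>y\<in>J. m y \<theta> * norm (y - \<theta>))
          \<le> (\<Sum>y\<in>J. m y \<theta> * (s + (norm (y - \<theta>))\<^sup>2))"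
        unfolding sum_distrib_left
      proof (rule sum_mono)
        fix y
        have "2 * sqrt s * norm (y - \<theta>) \<le> s + (norm (y - \<theta>))\<^sup>2"
          using sum_squares_bound[of "sqrt s" "norm (y - \<theta>)"] s0 by simp
        from mult_left_mono[OF this m0[OF \<theta>, of y]]
        show "2 * sqrt s * (m y \<theta> * norm (y - \<theta>)) \<le> m y \<theta> * (s + (norm (y - \<theta>))\<^sup>2)"
          by (simp only: mult_ac)
      qed
      also have "\<dots> = s + (\<Sum>y\<in>J. (norm (y - \<theta>))\<^sup>2 * m y \<theta>)"
        using sum_m[OF \<theta>'] by (simp add: distrib_left sum.distrib mult.commute flip: sum_distrib_left)
      also have "\<dots> \<le> 2 * sqrt s * sqrt s"
        using s real_sqrt_mult_self[of s] s0 by (simp add: mult.assoc)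
      finally show ?thesis by (rule mult_left_le_imp_le) (use sq in simp)
    qed
    finally have "norm ((\<Sum>y\<in>J. m y \<theta> *\<^sub>R y) - \<theta>) \<le> sqrt s" .
    then have "L * norm ((\<Sum>y\<in>J. m y \<theta> *\<^sub>R y) - \<theta>) \<le> L * sqrt s"
      by (rule mult_left_mono[OF _ L(1)])
    then show "norm (W \<theta>) \<le> L * sqrt ((b + \<delta>) / (\<epsilon> * real n))"
      using L(2) unfolding W_def T_def s_def by (rule order_trans[rotated])
    obtain K where trK: "Re (\<Sum>s\<in>?I. K s s) = real n"
      and K: "\<And>h A. A \<in> sets X \<Longrightarrow>
        2 * Re (mtrace ?I (dtensor n (\<rho> \<theta>) (\<rho>' \<theta> h)) (M A))
         \<le> real n * (h \<bullet> (quantum_information \<rho> \<theta> *v h)) * Re (mtrace ?I (tensor_power n (\<rho> \<theta>)) (M A))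
            + Re (mtrace ?I K (M A)) / real n"
      by (rule information_inequality[OF \<Theta> \<theta>' \<rho>'[OF \<theta>'] model n M refinable]) blast+
    \<comment> \<open>Each event uses its own direction \<open>T (y - \<theta>)\<close> with the
      same \<open>K\<close>; the \<open>K\<close>-terms add up to n / n, the source of the 1 in the
      bound.\<close>
    have "2 * (\<Sum>y\<in>J. m' y \<theta> (T (y - \<theta>)))
        \<le> (\<Sum>y\<in>J. real n * (q (y - \<theta>) * m y \<theta>) + Re (mtrace ?I K (M (A y))) / real n)"
      unfolding sum_distrib_left
    proof (rule sum_mono)
      fix y
      let ?h = "T (y - \<theta>)"
      have "2 * m' y \<theta> ?h \<le> real n * (?h \<bullet> (quantum_information \<rho> \<theta> *v ?h)) * m y \<theta>
          + Re (mtrace ?I K (M (A y))) / real n"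
        unfolding m'_def m_def by (rule K[OF A])
      also have "\<dots> \<le> real n * q (y - \<theta>) * m y \<theta> + Re (mtrace ?I K (M (A y))) / real n"
        unfolding T_def by (intro add_right_mono mult_right_mono mult_left_mono dom m0 \<theta>) simp
      finally show "2 * m' y \<theta> ?h \<le> real n * (q (y - \<theta>) * m y \<theta>) + Re (mtrace ?I K (M (A y))) / real n"
        by (simp only: mult.assoc)
    qed
    also have "\<dots> = real n * (\<Sum>y\<in>J. q (y - \<theta>) * m y \<theta>) + Re (\<Sum>y\<in>J. mtrace ?I K (M (A y))) / real n"
      by (simp add: sum.distrib sum_distrib_left sum_divide_distrib)
    also have "\<dots> \<le> b + \<delta> + 1"
      unfolding partition trK using qm[OF \<theta>] n0 by simp
    finally show "(\<Sum>k\<in>UNIV. W' \<theta> (axis k 1) $ k) \<le> (b + \<delta> + 1) / 2 - trace D"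
      unfolding div_eq[OF \<theta>'] by simp
  qed
qed

text \<open>In Pauli coordinates the form is s^2 + |l|^2 + 2 s (a . l), which is at least (|s| -
  |l|)^2 because |a| \<le> 1.\<close>

lemma quantum_information_nonneg:
  fixes \<rho> :: "real^'p \<Rightarrow> complex^2^2"
  assumes \<Theta>: "open \<Theta>" "\<theta> \<in> \<Theta>" and D: "(\<rho> has_derivative D) (at \<theta>)"
    and model: "pure_state_model \<Theta> \<rho> \<or> mixed_state_model \<Theta> \<rho>"
  shows "0 \<le> h \<bullet> (quantum_information \<rho> \<theta> *v h)"
proof -
  let ?L = "\<Sum>i\<in>UNIV. (h $ i) *\<^sub>R quantum_score \<rho> \<theta> i"
  have "self_adjoint ?L"
    by (rule self_adjoint_sum_scaleR)
       (use is_quantum_score_quantum_score(1)[OF \<Theta> D model] in \<open>simp add: is_quantum_score_def\<close>)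
  then obtain s l where L: "?L = pauli s l" by (rule self_adjoint_pauliE)
  obtain a where a: "\<rho> \<theta> = bloch_state a" "norm a \<le> 1"
    using model \<Theta> unfolding pure_state_model_def mixed_state_model_def
    by (metis less_eq_real_def order_refl)
  have "Re (trace (\<rho> \<theta> ** (?L ** ?L))) = s\<^sup>2 + (norm l)\<^sup>2 + 2 * (s * (a \<bullet> l))"
    unfolding L a bloch_state_pauli pauli_square power2_norm_eq_inner
    by (simp add: trace_pauli_mult power2_eq_square)
  moreover have "\<bar>s * (a \<bullet> l)\<bar> \<le> \<bar>s\<bar> * norm l"
  proof -
    have "\<bar>a \<bullet> l\<bar> \<le> norm a * norm l" by (rule Cauchy_Schwarz_ineq2)
    also have "\<dots> \<le> norm l" using a(2) by (simp add: mult_left_le_one_le)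
    finally show ?thesis unfolding abs_mult by (rule mult_left_mono) simp
  qed
  moreover have "2 * (\<bar>s\<bar> * norm l) \<le> s\<^sup>2 + (norm l)\<^sup>2"
    using sum_squares_bound[of "\<bar>s\<bar>" "norm l"] by simp
  ultimately show ?thesis unfolding quantum_information_quadratic_form by linarith
qed

lemma inner_matrix_vector_mult: "z \<bullet> (C *v z) = (\<Sum>i\<in>UNIV. \<Sum>j\<in>UNIV. C $ i $ j * (z $ i * z $ j))"
  for C :: "real^'p^'p"
  by (simp add: inner_vec_def matrix_vector_mult_def sum_distrib_left mult_ac)

lemma inner_matrix_vector_mult_le:
  fixes C :: "real^'p^'p"
  shows "z \<bullet> (C *v z) \<le> (\<Sum>i\<in>UNIV. \<Sum>j\<in>UNIV. \<bar>C $ i $ j\<bar>) * (norm z)\<^sup>2"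
  unfolding inner_matrix_vector_mult sum_distrib_right
proof (intro sum_mono)
  fix i j
  have "\<bar>z $ i\<bar> * \<bar>z $ j\<bar> \<le> norm z * norm z"
    by (intro mult_mono component_le_norm_cart) auto
  then have "\<bar>C $ i $ j\<bar> * \<bar>z $ i * z $ j\<bar> \<le> \<bar>C $ i $ j\<bar> * (norm z)\<^sup>2"
    unfolding abs_mult power2_eq_square by (rule mult_left_mono) simp
  then show "C $ i $ j * (z $ i * z $ j) \<le> \<bar>C $ i $ j\<bar> * (norm z)\<^sup>2"
    unfolding abs_mult[symmetric] by linarith
qed

lemma matrix_inv_cancel:
  fixes A :: "real^'p^'p"
  assumes "invertible A"
  shows "A ** matrix_inv A = mat 1" "matrix_inv A ** A = mat 1"
  using someI_ex[OF assms[unfolded invertible_def]] unfolding matrix_inv_def by blast+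

text \<open>\<open>finite_mse\<close> is part of the convergence hypothesis: a non-integrable error
  would have Bochner integral 0 and could simulate convergence. The contradiction at a bad point
  needs only one sufficiently large \<open>n\<close>.\<close>

theorem theorem3p1:
  fixes \<Theta> U :: "(real^'p) set"
    and \<rho> :: "real^'p \<Rightarrow> complex^2^2"
    and X :: "nat \<Rightarrow> 'x measure"
    and M :: "nat \<Rightarrow> 'x set \<Rightarrow> 2 list \<Rightarrow> 2 list \<Rightarrow> complex"
    and est :: "nat \<Rightarrow> 'x \<Rightarrow> real^'p"
    and V :: "real^'p \<Rightarrow> real^'p^'p"
  assumes open_Theta: "open \<Theta>"
    and model: "spin_half_model \<Theta> \<rho>"
    and smooth: "C1_on \<Theta> \<rho>"
    and pure_or_mixed: "pure_state_model \<Theta> \<rho> \<or> mixed_state_model \<Theta> \<rho>"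
    and meas: "\<And>n. n \<ge> 1 \<Longrightarrow> measurement (copies_basis n) (X n) (M n)"
    and refinable: "\<And>n. mixed_state_model \<Theta> \<rho> \<Longrightarrow> n \<ge> 1 \<Longrightarrow>
          \<exists>(Y :: 'y measure) N. measurement (copies_basis n) Y N \<and>
            refinement (copies_basis n) Y N (X n) (M n) \<and> product_form n Y N"
    and estimator: "\<And>n. n \<ge> 1 \<Longrightarrow> est n \<in> borel_measurable (X n)"
    and U: "open U" "U \<subseteq> \<Theta>"
    and finite_mse: "\<forall>\<^sub>F n in sequentially. \<forall>\<theta>\<in>U.
          mse_finite (copies_distribution n (\<rho> \<theta>) (X n) (M n)) (est n) \<theta>"
    and limit: "uniform_limit U
          (\<lambda>n \<theta>. real n *\<^sub>R mse_matrix (copies_distribution n (\<rho> \<theta>) (X n) (M n)) (est n) \<theta>)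
          V sequentially"
    and V_cont: "continuous_on U V"
    and IQ_cont: "continuous_on U (quantum_information \<rho>)"
    and IQ_partials: "bounded_partial_derivatives_on U (quantum_information \<rho>)"
    and V_nonsingular: "\<And>\<theta>. \<theta> \<in> U \<Longrightarrow> invertible (V \<theta>)"
    and IQ_nonsingular: "\<And>\<theta>. \<theta> \<in> U \<Longrightarrow> invertible (quantum_information \<rho> \<theta>)"
  shows "\<forall>\<theta>\<in>U. trace (matrix_inv (quantum_information \<rho> \<theta>) ** matrix_inv (V \<theta>)) \<le> 1"
proof (intro ballI, rule ccontr)
  fix \<theta>0 assume \<theta>0: "\<theta>0 \<in> U"
  define IQ where "IQ = quantum_information \<rho>"
  define T where "T = trace (matrix_inv (IQ \<theta>0) ** matrix_inv (V \<theta>0))"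
  assume "\<not> trace (matrix_inv (quantum_information \<rho> \<theta>0) ** matrix_inv (V \<theta>0)) \<le> 1"
  then have T: "1 < T" by (simp add: T_def IQ_def)
  \<comment> \<open>Four losses of \<open>\<kappa>\<close> are to come: the coercive term,
    continuity of \<open>V\<close>, uniform convergence and rounding. With 8 in the denominator the
    divergence is still at most \<open>- (2 * \<kappa>)\<close>.\<close>
  define \<kappa> where "\<kappa> = (T - 1) / 8"
  have \<kappa>: "0 < \<kappa>" using T by (simp add: \<kappa>_def)
  obtain \<rho>' where \<rho>': "\<And>\<theta>. \<theta> \<in> \<Theta> \<Longrightarrow> (\<rho> has_derivative blinfun_apply (\<rho>' \<theta>)) (at \<theta>)"
    and \<rho>'_cont: "continuous_on \<Theta> \<rho>'"
    using smooth unfolding C1_on_def by blast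
  define Vn where "Vn n \<theta> = real n *\<^sub>R mse_matrix (copies_distribution n (\<rho> \<theta>) (X n) (M n)) (est n) \<theta>" for n \<theta>
  have lim: "uniform_limit U Vn V sequentially" using limit by (simp add: Vn_def[abs_def])
  have V_sym: "V \<theta>0 $ i $ j = V \<theta>0 $ j $ i" for i j
  proof -
    have lim_ij: "(\<lambda>n. Vn n \<theta>0 $ i $ j) \<longlonglongrightarrow> V \<theta>0 $ i $ j" for i j
      by (intro tendsto_vec_nth tendsto_uniform_limitI[OF lim \<theta>0])
    have "(\<lambda>n. Vn n \<theta>0 $ i $ j) = (\<lambda>n. Vn n \<theta>0 $ j $ i)"
      by (simp add: Vn_def mse_matrix_def mult.commute)
    with lim_ij[of i j] have "(\<lambda>n. Vn n \<theta>0 $ j $ i) \<longlonglongrightarrow> V \<theta>0 $ i $ j" by simp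
    then show ?thesis using lim_ij[of j i] by (rule LIMSEQ_unique)
  qed
  have V_tr: "transpose (V \<theta>0) = V \<theta>0" using V_sym by (simp add: transpose_def vec_eq_iff)
  have IQ_tr: "transpose (IQ \<theta>0) = IQ \<theta>0"
    by (simp add: transpose_def vec_eq_iff IQ_def quantum_information_def add.commute)
  define D where "D = matrix_inv (V \<theta>0) ** matrix_inv (IQ \<theta>0)"
  have V_inv: "V \<theta>0 ** matrix_inv (V \<theta>0) = mat 1"
    using V_nonsingular[OF \<theta>0] by (rule matrix_inv_cancel)
  have IQ_inv: "matrix_inv (IQ \<theta>0) ** IQ \<theta>0 = mat 1"
    using IQ_nonsingular[OF \<theta>0] unfolding IQ_def by (rule matrix_inv_cancel)
  have trD: "trace D = T" unfolding D_def T_def by (rule trace_mul_sym)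
  have "IQ \<theta>0 ** transpose D = transpose (D ** IQ \<theta>0)" by (simp add: matrix_transpose_mul IQ_tr)
  also have "D ** IQ \<theta>0 = matrix_inv (V \<theta>0)" by (simp add: D_def matrix_mul_assoc[symmetric] IQ_inv)
  finally have "(IQ \<theta>0 ** transpose D) ** V \<theta>0 = transpose (V \<theta>0 ** matrix_inv (V \<theta>0))"
    by (simp add: matrix_transpose_mul V_tr)
  \<comment> \<open>This cancellation reduces the limiting loss tr(D I_Q D^T V) to tr D.\<close>
  then have DT: "IQ \<theta>0 ** transpose D ** V \<theta>0 = mat 1" by (simp add: V_inv)
  \<comment> \<open>Small enough that the coercive term adds at most \<open>\<kappa>\<close> to the
    limiting loss.\<close>
  define \<epsilon> where "\<epsilon> = \<kappa> / (\<bar>trace (V \<theta>0)\<bar> + 1)"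
  have \<epsilon>: "0 < \<epsilon>" using \<kappa> by (simp add: \<epsilon>_def)
  define C where "C = D ** IQ \<theta>0 ** transpose D + \<epsilon> *\<^sub>R mat 1"
  define q where "q z = z \<bullet> (C *v z)" for z
  \<comment> \<open>For symmetric \<open>A\<close> this is the trace of \<open>C ** A\<close>.
    Applied to the normalised error matrix it gives \<open>n\<close> times the expected
    loss.\<close>
  define \<tau> where "\<tau> A = (\<Sum>i\<in>UNIV. \<Sum>j\<in>UNIV. C $ i $ j * A $ i $ j)" for A :: "real^'p^'p"
  have q_eq: "q z = (transpose D *v z) \<bullet> (IQ \<theta>0 *v (transpose D *v z)) + \<epsilon> * (norm z)\<^sup>2" for z
    unfolding q_def C_def
    by (simp add: matrix_vector_mult_add_rdistrib inner_add_right power2_norm_eq_inner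
        scaleR_matrix_vector_assoc[symmetric] matrix_vector_mul_assoc[symmetric]
        dot_lmul_matrix[symmetric] transpose_matrix_vector)
  have q_cont: "continuous_on UNIV q"
    unfolding q_def by (intro continuous_intros matrix_vector_mult_linear_continuous_on)
  have "0 \<le> h \<bullet> (IQ \<theta>0 *v h)" for h
    unfolding IQ_def using \<theta>0 U by (intro quantum_information_nonneg[OF open_Theta _ \<rho>' pure_or_mixed]) auto
  then have coer: "\<epsilon> * (norm z)\<^sup>2 \<le> q z" for z by (simp add: q_eq)
  have "\<tau> (V \<theta>0) = trace (C ** V \<theta>0)"
    unfolding \<tau>_def trace_def matrix_matrix_mult_def by (simp add: V_sym)
  also have "\<dots> = trace (D ** (IQ \<theta>0 ** transpose D ** V \<theta>0)) + \<epsilon> * trace (V \<theta>0)"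
    unfolding C_def
    by (simp add: matrix_mul_assoc matrix_add_rdistrib trace_add trace_scaleR flip: scalar_matrix_assoc)
  also have "\<dots> = T + \<epsilon> * trace (V \<theta>0)" by (simp add: DT trD)
  also have "\<epsilon> * trace (V \<theta>0) \<le> \<kappa>"
  proof -
    have "\<epsilon> * trace (V \<theta>0) \<le> \<epsilon> * (\<bar>trace (V \<theta>0)\<bar> + 1)" using \<epsilon> by (intro mult_left_mono) auto
    then show ?thesis by (simp add: \<epsilon>_def)
  qed
  finally have \<tau>0: "\<tau> (V \<theta>0) < T + 2 * \<kappa>" using \<kappa> by simp
  have \<tau>_cont: "continuous_on U (\<lambda>\<theta>. \<tau> (V \<theta>))"
    unfolding \<tau>_def by (intro continuous_intros V_cont)
  obtain L where L: "0 < L" "\<And>z. norm (transpose D *v z) \<le> norm z * L"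
    using bounded_linear.pos_bounded[OF matrix_vector_mul_bounded_linear[of "transpose D"]] by blast
  \<comment> \<open>An entrywise norm dominating the change of the information form. Below
    \<epsilon> / L^2 that change, evaluated at D^T z, is at most \<epsilon> |z|^2 and so is absorbed
    by the coercive term.\<close>
  define \<sigma> where "\<sigma> \<theta> = (\<Sum>i\<in>UNIV. \<Sum>j\<in>UNIV. \<bar>(IQ \<theta> - IQ \<theta>0) $ i $ j\<bar>)" for \<theta>
  have \<sigma>_cont: "continuous_on U \<sigma>"
    unfolding \<sigma>_def IQ_def by (intro continuous_intros IQ_cont)
  have "\<forall>\<^sub>F \<theta> in nhds \<theta>0. \<theta> \<in> U" using U(1) \<theta>0 by (rule eventually_nhds_in_open)
  moreover have nhds: "(f \<longlongrightarrow> f \<theta>0) (nhds \<theta>0)" if "continuous_on U f" for f :: "real^'p \<Rightarrow> real"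
    using that continuous_on_eq_continuous_at[OF U(1), of f] \<theta>0
    unfolding isCont_def tendsto_at_iff_tendsto_nhds by blast
  have "\<forall>\<^sub>F \<theta> in nhds \<theta>0. \<tau> (V \<theta>) < T + 2 * \<kappa>"
    using nhds[OF \<tau>_cont] \<tau>0 by (rule order_tendstoD(2))
  moreover have "\<sigma> \<theta>0 < \<epsilon> / L\<^sup>2" using \<epsilon> L by (simp add: \<sigma>_def)
  then have "\<forall>\<^sub>F \<theta> in nhds \<theta>0. \<sigma> \<theta> < \<epsilon> / L\<^sup>2"
    using nhds[OF \<sigma>_cont] by (rule order_tendstoD(2)[rotated])
  ultimately have "\<forall>\<^sub>F \<theta> in nhds \<theta>0. \<theta> \<in> U \<and> \<tau> (V \<theta>) < T + 2 * \<kappa> \<and> \<sigma> \<theta> < \<epsilon> / L\<^sup>2"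
    by (intro eventually_conj)
  then obtain d where d: "0 < d" "\<And>\<theta>. dist \<theta> \<theta>0 < d \<Longrightarrow> \<theta> \<in> U \<and> \<tau> (V \<theta>) < T + 2 * \<kappa> \<and> \<sigma> \<theta> < \<epsilon> / L\<^sup>2"
    unfolding eventually_nhds_metric by blast
  define r where "r = d / 2"
  have r: "0 < r" using d by (simp add: r_def)
  have near: "\<theta> \<in> U" "\<tau> (V \<theta>) < T + 2 * \<kappa>" "\<sigma> \<theta> < \<epsilon> / L\<^sup>2" if "\<theta> \<in> cball \<theta>0 r" for \<theta>
    using d(2)[of \<theta>] that d(1) by (auto simp: r_def dist_commute)
  have ball: "cball \<theta>0 r \<subseteq> \<Theta>" using near(1) U by blast
  have dom: "(transpose D *v z) \<bullet> (quantum_information \<rho> \<theta> *v (transpose D *v z)) \<le> q z"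
    if \<theta>: "\<theta> \<in> cball \<theta>0 r" for \<theta> z
  proof -
    let ?h = "transpose D *v z"
    have "?h \<bullet> ((IQ \<theta> - IQ \<theta>0) *v ?h) \<le> \<sigma> \<theta> * (norm ?h)\<^sup>2"
      unfolding \<sigma>_def by (rule inner_matrix_vector_mult_le)
    also have "\<dots> \<le> \<epsilon> / L\<^sup>2 * (norm z * L)\<^sup>2"
      using near(3)[OF \<theta>] L \<epsilon> by (intro mult_mono power_mono) auto
    also have "\<dots> = \<epsilon> * (norm z)\<^sup>2" using L by (simp add: power_mult_distrib)
    finally show ?thesis
      unfolding q_eq IQ_def by (simp add: matrix_vector_mult_diff_rdistrib inner_diff_right)
  qed
  obtain K where K: "\<And>S W W' c \<delta>. open S \<Longrightarrow> cball \<theta>0 r \<subseteq> S \<Longrightarrow>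
     (\<And>x. x \<in> S \<Longrightarrow> (W has_derivative W' x) (at x)) \<Longrightarrow>
     (\<And>k. continuous_on S (\<lambda>x. W' x (axis k 1) $ k)) \<Longrightarrow>
     (\<And>x. x \<in> cball \<theta>0 r \<Longrightarrow> norm (W x :: real^'p) \<le> \<delta>) \<Longrightarrow>
     (\<And>x. x \<in> cball \<theta>0 r \<Longrightarrow> (\<Sum>k\<in>UNIV. W' x (axis k 1) $ k) \<le> - c) \<Longrightarrow> c \<le> K * \<delta>"
    by (rule divergence_bound[OF r, of \<theta>0]) blast
  define b where "b = T + 3 * \<kappa>"
  \<comment> \<open>An error below \<open>e\<close> in every entry changes \<open>\<tau>\<close> by
    at most \<open>\<kappa>\<close>; the added 1 keeps the denominator positive.\<close>
  define e where "e = \<kappa> / ((\<Sum>i\<in>UNIV. \<Sum>j\<in>UNIV. \<bar>C $ i $ j\<bar>) + 1)"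
  have Cpos: "0 \<le> (\<Sum>i\<in>UNIV. \<Sum>j\<in>UNIV. \<bar>C $ i $ j\<bar>)" by (intro sum_nonneg) auto
  have e: "0 < e" using \<kappa> Cpos by (simp add: e_def)
  have "\<forall>\<^sub>F n in sequentially. \<forall>\<theta>\<in>U. dist (Vn n \<theta>) (V \<theta>) < e"
    using lim e by (rule uniform_limitD)
  moreover have "(\<lambda>n. K * (L * sqrt ((b + \<kappa>) / (\<epsilon> * real n)))) \<longlonglongrightarrow> K * (L * sqrt 0)"
    using \<epsilon> by (intro tendsto_intros tendsto_divide_0[OF tendsto_const] filterlim_at_top_imp_at_infinity
        filterlim_tendsto_pos_mult_at_top[OF tendsto_const] filterlim_real_sequentially)
  then have "\<forall>\<^sub>F n in sequentially. K * (L * sqrt ((b + \<kappa>) / (\<epsilon> * real n))) < 2 * \<kappa>"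
    using \<kappa> by (intro order_tendstoD(2)) auto
  moreover note finite_mse
  moreover have "\<forall>\<^sub>F n in sequentially. (1::nat) \<le> n" by (rule eventually_ge_at_top)
  ultimately have "\<forall>\<^sub>F n in sequentially. (\<forall>\<theta>\<in>U. dist (Vn n \<theta>) (V \<theta>) < e) \<and>
      K * (L * sqrt ((b + \<kappa>) / (\<epsilon> * real n))) < 2 * \<kappa> \<and>
      (\<forall>\<theta>\<in>U. mse_finite (copies_distribution n (\<rho> \<theta>) (X n) (M n)) (est n) \<theta>) \<and> 1 \<le> n"
    by (intro eventually_conj)
  then obtain n where close: "\<And>\<theta>. \<theta> \<in> U \<Longrightarrow> dist (Vn n \<theta>) (V \<theta>) < e"
    and small: "K * (L * sqrt ((b + \<kappa>) / (\<epsilon> * real n))) < 2 * \<kappa>"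
    and mse: "\<And>\<theta>. \<theta> \<in> U \<Longrightarrow> mse_finite (copies_distribution n (\<rho> \<theta>) (X n) (M n)) (est n) \<theta>"
    and n: "1 \<le> n"
    using eventually_happens'[OF sequentially_bot] by blast
  let ?P = "\<lambda>\<theta>. copies_distribution n (\<rho> \<theta>) (X n) (M n)"
  have q_sum: "q (est n x - \<theta>) = (\<Sum>i\<in>UNIV. \<Sum>j\<in>UNIV. C $ i $ j *
      ((est n x $ i - \<theta> $ i) * (est n x $ j - \<theta> $ j)))" for x \<theta>
    unfolding q_def inner_matrix_vector_mult by simp
  have mse_int: "integrable (?P \<theta>) (\<lambda>x. (est n x $ i - \<theta> $ i) * (est n x $ j - \<theta> $ j))"
    if "\<theta> \<in> U" for \<theta> i j using mse[OF that] unfolding mse_finite_def by blast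
  have int: "integrable (?P \<theta>) (\<lambda>x. q (est n x - \<theta>))" if "\<theta> \<in> U" for \<theta>
    unfolding q_sum by (intro Bochner_Integration.integrable_sum integrable_mult_right mse_int that)
  have int_eq: "real n * integral\<^sup>L (?P \<theta>) (\<lambda>x. q (est n x - \<theta>)) = \<tau> (Vn n \<theta>)" if "\<theta> \<in> U" for \<theta>
  proof -
    have "integral\<^sup>L (?P \<theta>) (\<lambda>x. q (est n x - \<theta>)) = (\<Sum>i\<in>UNIV. \<Sum>j\<in>UNIV. C $ i $ j *
        integral\<^sup>L (?P \<theta>) (\<lambda>x. (est n x $ i - \<theta> $ i) * (est n x $ j - \<theta> $ j)))"
      unfolding q_sum
      by (simp only: Bochner_Integration.integral_sum Bochner_Integration.integrable_sum
          integrable_mult_right mse_int[OF that] integral_mult_right_zero)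
    then show ?thesis
      by (simp add: \<tau>_def Vn_def mse_matrix_def sum_distrib_left mult_ac)
  qed
  have b: "real n * integral\<^sup>L (?P \<theta>) (\<lambda>x. q (est n x - \<theta>)) \<le> b" if \<theta>: "\<theta> \<in> cball \<theta>0 r" for \<theta>
  proof -
    have "\<tau> (Vn n \<theta>) - \<tau> (V \<theta>) = (\<Sum>i\<in>UNIV. \<Sum>j\<in>UNIV. C $ i $ j * (Vn n \<theta> - V \<theta>) $ i $ j)"
      by (simp add: \<tau>_def sum_subtractf right_diff_distrib)
    also have "\<dots> \<le> (\<Sum>i\<in>UNIV. \<Sum>j\<in>UNIV. \<bar>C $ i $ j\<bar> * e)"
    proof (intro sum_mono)
      fix i j
      have "\<bar>(Vn n \<theta> - V \<theta>) $ i $ j\<bar> \<le> norm (Vn n \<theta> - V \<theta>)"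
        using component_le_norm_cart[of "(Vn n \<theta> - V \<theta>) $ i" j] Finite_Cartesian_Product.norm_nth_le[of "Vn n \<theta> - V \<theta>" i] by linarith
      also have "\<dots> \<le> e" using close[OF near(1)[OF \<theta>]] by (simp add: dist_norm)
      finally have "\<bar>C $ i $ j\<bar> * \<bar>(Vn n \<theta> - V \<theta>) $ i $ j\<bar> \<le> \<bar>C $ i $ j\<bar> * e" by (rule mult_left_mono) simp
      then show "C $ i $ j * (Vn n \<theta> - V \<theta>) $ i $ j \<le> \<bar>C $ i $ j\<bar> * e"
        unfolding abs_mult[symmetric] by linarith
    qed
    also have "\<dots> = (\<Sum>i\<in>UNIV. \<Sum>j\<in>UNIV. \<bar>C $ i $ j\<bar>) * e" by (simp add: sum_distrib_right)
    also have "\<dots> \<le> \<kappa>" using \<kappa> Cpos by (simp add: e_def field_simps)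
    finally show ?thesis unfolding int_eq[OF near(1)[OF \<theta>]] b_def using near(2)[OF \<theta>] by linarith
  qed
  have refinable': "mixed_state_model \<Theta> \<rho> \<Longrightarrow> \<exists>(Y :: 'y measure) N.
      refinement (copies_basis n) Y N (X n) (M n) \<and> product_form n Y N"
    using refinable[OF _ n] by blast
  obtain W W' where W:
    "\<And>\<theta>. \<theta> \<in> \<Theta> \<Longrightarrow> (W has_derivative W' \<theta>) (at \<theta>)"
    "\<And>k. continuous_on \<Theta> (\<lambda>\<theta>. W' \<theta> (axis k 1) $ k)"
    "\<And>\<theta>. \<theta> \<in> cball \<theta>0 r \<Longrightarrow> norm (W \<theta> :: real^'p) \<le> L * sqrt ((b + \<kappa>) / (\<epsilon> * real n))"
    "\<And>\<theta>. \<theta> \<in> cball \<theta>0 r \<Longrightarrow> (\<Sum>k\<in>UNIV. W' \<theta> (axis k 1) $ k) \<le> (b + \<kappa> + 1) / 2 - trace D"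
  proof (rule bias_vector_field[OF open_Theta \<rho>' _ pure_or_mixed n meas[OF n] refinable' estimator[OF n]
        q_cont \<epsilon> coer ball order_less_imp_le[OF r] dom int[OF near(1)] b \<kappa> order_less_imp_le[OF L(1)]])
    show "continuous_on \<Theta> (\<lambda>\<theta>. blinfun_apply (\<rho>' \<theta>) h)" for h
      by (intro continuous_intros \<rho>'_cont)
    show "norm (transpose D *v z) \<le> L * norm z" for z using L(2)[of z] by (simp add: mult.commute)
  qed blast+
  \<comment> \<open>The divergence bound is independent of \<open>n\<close>, whereas the field was
    made too small, by the choice of \<open>n\<close>, to allow it.\<close>
  have "(b + \<kappa> + 1) / 2 - trace D = - (2 * \<kappa>)" by (simp add: trD b_def \<kappa>_def field_simps)
  then have "2 * \<kappa> \<le> K * (L * sqrt ((b + \<kappa>) / (\<epsilon> * real n)))"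
    using W by (intro K[OF open_Theta ball W(1-3)]) auto
  then show False using small by simp
qed

end
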